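(* Let $n\ge1$, let $K^r$ denote the distribution of the down-up walk on the $n$th level of the Schur lattice started from the one-row partition $(n)$ after $r$ steps, and let $\pi$ denote the shifted Plancherel measure on $DP(n)$. For $r=\frac12 n\log(n)+cn$ (a non-negative integer) with $c>0$, $$\|K^r-\pi\|\le\frac{e^{-3c}}{4}.$$
   Context: $DP(n)$ is the set of partitions of $n$ into distinct parts; $l(\lambda)$ is the number of parts of $\lambda$; $g_\lambda$ is the number of standard shifted tableaux of shape $\lambda$. The shifted Plancherel measure is $\pi(\lambda)=\frac{2^{n-l(\lambda)}g_\lambda^2}{n!}$ for $\lambda\in DP(n)$. Write $\tau\nearrow\lambda$ if $\tau,\lambda$ are partitions into distinct parts and the diagram of $\lambda$ is obtained from that of $\tau$ by adding one box. The down-up walk on the $n$th level of the Schur lattice is the Markov chain on $DP(n)$ which moves from $\lambda$ to $\rho$ with probability $$\frac{2g_\rho}{n\,g_\lambda}\sum_{\tau\in DP(n-1),\ \tau\nearrow\lambda,\ \tau\nearrow\rho}2^{l(\tau)-l(\rho)}.$$ The total variation distance between probabilities $P,Q$ on a finite set $X$ is $\|P-Q\|=\frac12\sum_{x\in X}|P(x)-Q(x)|$. $\log$ is the natural logarithm. *)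

theory Defs
  imports Complex_Main
begin

text \<open>A partition into distinct parts is the strictly decreasing list of its (positive) parts.\<close>

definition DP :: "nat \<Rightarrow> nat list set" where
  "DP n = {\<mu>. sorted_wrt (>) \<mu> \<and> (\<forall>k\<in>set \<mu>. 0 < k) \<and> sum_list \<mu> = n}"

text \<open>Boxes are pairs (row, column), counted from 0; row \<open>i\<close> is shifted \<open>i\<close> places to the right.\<close>

definition shifted_diagram :: "nat list \<Rightarrow> (nat \<times> nat) set" where
  "shifted_diagram \<mu> = {(i, j). i < length \<mu> \<and> i \<le> j \<and> j < i + \<mu> ! i}"

text \<open>The value 0 outside the diagram is a convention that makes a tableau the same thing as its
  filling, so that tableaux can be counted.\<close>

definition standard_shifted_tableaux :: "nat list \<Rightarrow> (nat \<times> nat \<Rightarrow> nat) set" where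
  "standard_shifted_tableaux \<mu> =
    {T. bij_betw T (shifted_diagram \<mu>) {1..sum_list \<mu>} \<and>
        (\<forall>b. b \<notin> shifted_diagram \<mu> \<longrightarrow> T b = 0) \<and>
        (\<forall>i j j'. (i, j) \<in> shifted_diagram \<mu> \<and> (i, j') \<in> shifted_diagram \<mu> \<and> j < j'
            \<longrightarrow> T (i, j) < T (i, j')) \<and>
        (\<forall>i i' j. (i, j) \<in> shifted_diagram \<mu> \<and> (i', j) \<in> shifted_diagram \<mu> \<and> i < i'
            \<longrightarrow> T (i, j) < T (i', j))}"

definition num_sst :: "nat list \<Rightarrow> nat" where
  "num_sst \<mu> = card (standard_shifted_tableaux \<mu>)"

text \<open>The truncated subtraction is harmless: \<open>length \<mu> \<le> n\<close> for \<open>\<mu> \<in> DP n\<close>.\<close>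

definition shifted_plancherel :: "nat \<Rightarrow> nat list \<Rightarrow> real" where
  "shifted_plancherel n \<mu> = 2 ^ (n - length \<mu>) * (real (num_sst \<mu>))\<^sup>2 / fact n"

definition covers :: "nat list \<Rightarrow> nat list \<Rightarrow> bool"  (infix "\<nearrow>" 50) where
  "\<tau> \<nearrow> \<mu> \<longleftrightarrow> \<tau> \<in> DP (sum_list \<tau>) \<and> \<mu> \<in> DP (sum_list \<mu>) \<and>
     (\<exists>b. b \<notin> shifted_diagram \<tau> \<and> shifted_diagram \<mu> = insert b (shifted_diagram \<tau>))"

text \<open>Probability of moving from \<open>\<mu>\<close> to \<open>\<rho>\<close>, for \<open>\<mu>\<close> and \<open>\<rho>\<close> in \<open>DP n\<close> and \<open>n \<ge> 1\<close>.\<close>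

definition down_up :: "nat \<Rightarrow> nat list \<Rightarrow> nat list \<Rightarrow> real" where
  "down_up n \<mu> \<rho> = 2 * real (num_sst \<rho>) / (real n * real (num_sst \<mu>)) *
     (\<Sum>\<tau> | \<tau> \<in> DP (n - 1) \<and> \<tau> \<nearrow> \<mu> \<and> \<tau> \<nearrow> \<rho>. 2 powi (int (length \<tau>) - int (length \<rho>)))"

text \<open>Distribution after \<open>r\<close> steps of the Markov chain on the finite set \<open>X\<close> with transition
  probabilities \<open>K\<close>, started from \<open>x\<close>.\<close>

primrec chain_dist :: "'a set \<Rightarrow> ('a \<Rightarrow> 'a \<Rightarrow> real) \<Rightarrow> 'a \<Rightarrow> nat \<Rightarrow> 'a \<Rightarrow> real" where
  "chain_dist X K x 0 y = (if y = x then 1 else 0)"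
| "chain_dist X K x (Suc r) y = (\<Sum>z\<in>X. chain_dist X K x r z * K z y)"

definition tv_dist :: "'a set \<Rightarrow> ('a \<Rightarrow> real) \<Rightarrow> ('a \<Rightarrow> real) \<Rightarrow> real" where
  "tv_dist X P Q = (1 / 2) * (\<Sum>x\<in>X. \<bar>P x - Q x\<bar>)"

text \<open>The sums and cardinalities above range over finite sets.\<close>

lemma finite_DP: "finite (DP n)"
proof -
  have *: "length xs \<le> sum_list xs" if "\<forall>k\<in>set xs. 0 < k" for xs :: "nat list"
    using that by (induction xs) auto
  have "DP n \<subseteq> {xs. set xs \<subseteq> {..n} \<and> length xs \<le> n}"
    unfolding DP_def using * member_le_sum_list by fastforce
  thus ?thesis
    by (rule finite_subset) (simp add: finite_lists_length_le)
qed

lemma finite_shifted_diagram: "finite (shifted_diagram \<mu>)"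
proof -
  have "shifted_diagram \<mu> = (SIGMA i:{..<length \<mu>}. {i..<i + \<mu> ! i})"
    by (auto simp: shifted_diagram_def)
  thus ?thesis by simp
qed

lemma finite_standard_shifted_tableaux: "finite (standard_shifted_tableaux \<mu>)"
proof -
  let ?F = "{T. \<forall>b. (b \<in> shifted_diagram \<mu> \<longrightarrow> T b \<in> {1..sum_list \<mu>}) \<and>
      (b \<notin> shifted_diagram \<mu> \<longrightarrow> T b = 0)}"
  have "finite ?F"
    by (rule finite_set_of_finite_funs) (auto simp: finite_shifted_diagram)
  moreover have "standard_shifted_tableaux \<mu> \<subseteq> ?F"
    by (auto simp: standard_shifted_tableaux_def dest: bij_betwE)
  ultimately show ?thesis
    by (rule finite_subset[rotated])
qed

end

(* Adding and removing a box satisfy the commutation relation U D = D U + I on strict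
   partitions, where U carries the weight 2 when no new row is created and D is unweighted; in
   terms of the set of parts this is a telescoping sum.  It makes the number of standard shifted
   tableaux an eigenfunction of U, so that the down-up walk is a reversible chain with
   stationary distribution pi.  By Cauchy-Schwarz, 4 TV^2 <= K^(2r)(x,x) / pi(x) - 1.  For the
   one-row partition x = (n), which covers only (n-1), the commutation relation determines
   K^s(x,x) / pi(x) = sum_k (n choose k) k! E_k (1 - k/n)^s, where the E_k have generating function
   e^(-t) (1 + t/2) / (1 - t/2).  Here E_0 = 1, E_1 = E_2 = 0 and 0 <= E_k <= 2^(-k), which for
   s = 2r leaves at most e^(-6c) (1/8 + 1/16 + ...) = e^(-6c) / 4. *)

theory Submission
  imports Defs "HOL-Computational_Algebra.Formal_Power_Series"
begin

subsection \<open>Strict partitions and their covers\<close>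

text \<open>Origin of the E_k: at s = 0 the return ratio of (n) is 1 / pi((n)), which is 2 n! / 2^n
  for n >= 1 and 1 for n = 0. So sum_k E_k / (n-k)! has to be 2 / 2^n, respectively 1, which says
  E(x) e^x = 1 + 2 (x/2) + 2 (x/2)^2 + ... = (1 + x/2) / (1 - x/2). That the same numbers serve
  every s follows without constructing eigenvectors: with D U replaced by D U + t, both sides of the
  formula obey one recurrence in s, which calls for the value of n - 1 at t + 1. The parameter t is
  there to make this induction close. The exponent 3c reflects E_1 = E_2 = 0: the slowest mode seen
  from (n) decays like (1 - 3/n)^s. Its coefficient is at most n^3 / 8, and the given r is the time
  at which (1 - 3/n)^(2r) has dropped below e^(-6c) / n^3.\<close>

definition strict :: "nat list \<Rightarrow> bool" where
  "strict \<mu> \<longleftrightarrow> sorted_wrt (>) \<mu> \<and> (\<forall>k\<in>set \<mu>. 0 < k)"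

text \<open>Padding by zeros makes every added box, even one opening a new row, a change of the
  function at a single point.\<close>

definition part :: "nat list \<Rightarrow> nat \<Rightarrow> nat" where
  "part \<mu> i = (if i < length \<mu> then \<mu> ! i else 0)"

lemma mem_DP_iff: "\<mu> \<in> DP n \<longleftrightarrow> strict \<mu> \<and> sum_list \<mu> = n"
  by (auto simp: DP_def strict_def)

lemma mem_shifted_diagram_iff: "(i, j) \<in> shifted_diagram \<mu> \<longleftrightarrow> i \<le> j \<and> j < i + part \<mu> i"
  by (auto simp: shifted_diagram_def part_def)

lemma card_shifted_diagram: "card (shifted_diagram \<mu>) = sum_list \<mu>"
proof -
  have "shifted_diagram \<mu> = (SIGMA i:{..<length \<mu>}. {i..<i + \<mu> ! i})"
    by (auto simp: shifted_diagram_def)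
  then show ?thesis
    by (simp add: sum_list_sum_nth lessThan_atLeast0)
qed

lemma part_eq_0_iff: "strict \<mu> \<Longrightarrow> part \<mu> i = 0 \<longleftrightarrow> length \<mu> \<le> i"
  by (auto simp: part_def strict_def)

lemma part_eqI:
  assumes "strict \<mu>" "strict \<nu>" "part \<mu> = part \<nu>"
  shows "\<mu> = \<nu>"
proof -
  have len: "length \<mu> = length \<nu>"
    using assms by (metis le_refl le_antisym part_eq_0_iff)
  moreover have "\<mu> ! i = \<nu> ! i" if "i < length \<mu>" for i
    using fun_cong[OF assms(3), of i] that len by (simp add: part_def)
  ultimately show ?thesis by (rule nth_equalityI)
qed

lemma part_Suc_less:
  "strict \<mu> \<Longrightarrow> part \<mu> (Suc i) < part \<mu> i \<or> part \<mu> i = 0 \<and> part \<mu> (Suc i) = 0"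
  by (auto simp: strict_def part_def sorted_wrt_iff_nth_less)

lemma part_less:
  "strict \<mu> \<Longrightarrow> i < j \<Longrightarrow> 0 < part \<mu> i \<Longrightarrow> part \<mu> j < part \<mu> i"
  by (auto simp: strict_def part_def sorted_wrt_iff_nth_less split: if_splits)

lemma part_inj:
  assumes "strict \<mu>" "part \<mu> i = part \<mu> j" "0 < part \<mu> i"
  shows "i = j"
  using part_less[of \<mu> i j] part_less[of \<mu> j i] assms by (cases i j rule: linorder_cases) auto

lemma set_eq_range_part:
  assumes "strict \<mu>"
  shows "set \<mu> = range (part \<mu>) - {0}"
proof (intro set_eqI iffI)
  fix x assume "x \<in> set \<mu>"
  then obtain i where "i < length \<mu>" "x = \<mu> ! i"
    by (auto simp: in_set_conv_nth)
  then have "x = part \<mu> i" by (simp add: part_def)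
  then show "x \<in> range (part \<mu>) - {0}"
    using assms \<open>x \<in> set \<mu>\<close> by (auto simp: strict_def)
qed (auto simp: part_def)

text \<open>Comparing neighbours suffices to recognise a sequence of row lengths, so the effect of
  changing one row is checked locally; the first zero gives the number of parts.\<close>

lemma strict_of_part:
  fixes p :: "nat \<Rightarrow> nat"
  assumes step: "\<And>i. p (Suc i) < p i \<or> p i = 0 \<and> p (Suc i) = 0" and "p m = 0"
  obtains \<mu> where "strict \<mu>" "part \<mu> = p"
proof
  define l where "l = (LEAST i. p i = 0)"
  have l: "p l = 0" "\<And>i. i < l \<Longrightarrow> 0 < p i"
    unfolding l_def using LeastI[of "\<lambda>i. p i = 0", OF \<open>p m = 0\<close>] not_less_Least by auto
  have ge: "p i = 0" if "l \<le> i" for i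
    using that by (induction i rule: dec_induct) (use l(1) step in force)+
  have less: "p j < p i" if "i < j" "j < l" for i j
    using that
  proof (induction j)
    case (Suc j)
    then show ?case
      using step[of j] l(2)[of j] by (cases "i = j") auto
  qed simp
  show "strict (map p [0..<l])"
    using less l(2) by (auto simp: strict_def sorted_wrt_iff_nth_less)
  show "part (map p [0..<l]) = p"
    using ge by (auto simp: part_def fun_eq_iff)
qed

section \<open>Shifted diagrams and addition of a box\<close>

lemma shifted_diagram_order_ideal:
  assumes "strict \<mu>" "(i', j') \<in> shifted_diagram \<mu>" "i \<le> i'" "j \<le> j'" "i \<le> j"
  shows "(i, j) \<in> shifted_diagram \<mu>"
proof -
  \<comment> \<open>Each row starts one column further right, but the parts drop by at least one, so
    the right ends of the nonempty rows weakly decrease.\<close>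
  have "i' + part \<mu> i' \<le> i + part \<mu> i" if "0 < part \<mu> i'"
    using \<open>i \<le> i'\<close> that
  proof (induction i' rule: dec_induct)
    case (step m)
    then show ?case using part_Suc_less[OF assms(1), of m] by auto
  qed simp
  then show ?thesis
    using assms by (auto simp: mem_shifted_diagram_iff)
qed

lemma shifted_diagram_inj:
  assumes "strict \<mu>" "strict \<nu>" "shifted_diagram \<mu> = shifted_diagram \<nu>"
  shows "\<mu> = \<nu>"
proof (rule part_eqI[OF assms(1,2)], rule ext)
  fix i
  have "{i..<i + part \<mu> i} = {i..<i + part \<nu> i}"
    using assms(3) by (auto simp: set_eq_iff) (metis mem_shifted_diagram_iff)+
  then have "card {i..<i + part \<mu> i} = card {i..<i + part \<nu> i}"
    by simp
  then show "part \<mu> i = part \<nu> i" by simp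
qed

lemma shifted_diagram_insert:
  assumes "part \<mu> = (part \<tau>)(i := Suc (part \<tau> i))"
  shows "shifted_diagram \<mu> = insert (i, i + part \<tau> i) (shifted_diagram \<tau>)"
    and "(i, i + part \<tau> i) \<notin> shifted_diagram \<tau>"
  using assms by (auto simp: mem_shifted_diagram_iff split: if_splits)

lemma coversD: "\<tau> \<nearrow> \<mu> \<Longrightarrow> strict \<tau> \<and> strict \<mu> \<and> sum_list \<mu> = Suc (sum_list \<tau>)"
  unfolding covers_def mem_DP_iff
  using card_insert_disjoint[OF finite_shifted_diagram[of \<tau>]]
  by (auto simp: card_shifted_diagram dest: arg_cong[where f = card])

lemma covers_iff_part:
  "\<tau> \<nearrow> \<mu> \<longleftrightarrow> strict \<tau> \<and> strict \<mu> \<and> (\<exists>i. part \<mu> = (part \<tau>)(i := Suc (part \<tau> i)))"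
proof (intro iffI; (elim conjE exE)?)
  assume "\<tau> \<nearrow> \<mu>"
  then obtain i j where b: "(i, j) \<notin> shifted_diagram \<tau>"
      "shifted_diagram \<mu> = insert (i, j) (shifted_diagram \<tau>)"
    by (auto simp: covers_def)
  \<comment> \<open>Row lengths are recovered by counting boxes, so the column of the added box need
    not be known.\<close>
  have row: "card {j. (i', j) \<in> shifted_diagram \<nu>} = part \<nu> i'" for \<nu> i'
  proof -
    have "{j. (i', j) \<in> shifted_diagram \<nu>} = {i'..<i' + part \<nu> i'}"
      by (auto simp: mem_shifted_diagram_iff)
    then show ?thesis by simp
  qed
  have fin: "finite {j. (i, j) \<in> shifted_diagram \<tau>}"
    by (rule finite_subset[of _ "{i..<i + part \<tau> i}"]) (auto simp: mem_shifted_diagram_iff)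
  have "{j'. (i, j') \<in> shifted_diagram \<mu>} = insert j {j'. (i, j') \<in> shifted_diagram \<tau>}"
    using b by auto
  then have "part \<mu> i = Suc (part \<tau> i)"
    using b fin row[of i] by (metis card_insert_disjoint mem_Collect_eq)
  moreover have "part \<mu> i' = part \<tau> i'" if "i' \<noteq> i" for i'
  proof -
    have "{j'. (i', j') \<in> shifted_diagram \<mu>} = {j'. (i', j') \<in> shifted_diagram \<tau>}"
      using b that by auto
    then show ?thesis using row by metis
  qed
  ultimately have "part \<mu> = (part \<tau>)(i := Suc (part \<tau> i))" by auto
  with coversD[OF \<open>\<tau> \<nearrow> \<mu>\<close>]
  show "strict \<tau> \<and> strict \<mu> \<and> (\<exists>i. part \<mu> = (part \<tau>)(i := Suc (part \<tau> i)))" by blast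
next
  fix i assume "strict \<tau>" "strict \<mu>" "part \<mu> = (part \<tau>)(i := Suc (part \<tau> i))"
  then show "\<tau> \<nearrow> \<mu>"
    unfolding covers_def mem_DP_iff using shifted_diagram_insert[of \<mu> \<tau> i] by blast
qed

lemma finite_covers: "finite {\<tau>. \<tau> \<nearrow> \<mu>}" "finite {\<rho>. \<mu> \<nearrow> \<rho>}"
proof -
  show "finite {\<tau>. \<tau> \<nearrow> \<mu>}"
    by (rule finite_subset[OF _ finite_DP[of "sum_list \<mu> - 1"]]) (auto simp: mem_DP_iff dest: coversD)
  show "finite {\<rho>. \<mu> \<nearrow> \<rho>}"
    by (rule finite_subset[OF _ finite_DP[of "Suc (sum_list \<mu>)"]]) (auto simp: mem_DP_iff dest: coversD)
qed

text \<open>A cover replaces a part \<open>k\<close> by \<open>k + 1\<close>, where a new part 1 counts as replacing \<open>k = 0\<close>.\<close>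

definition raisable :: "nat \<Rightarrow> nat set \<Rightarrow> bool" where
  "raisable k S \<longleftrightarrow> (k = 0 \<or> k \<in> S) \<and> Suc k \<notin> S"

definition raise :: "nat \<Rightarrow> nat set \<Rightarrow> nat set" where
  "raise k S = insert (Suc k) (S - {k})"

definition lowerable :: "nat \<Rightarrow> nat set \<Rightarrow> bool" where
  "lowerable k S \<longleftrightarrow> k \<notin> S \<and> Suc k \<in> S"

definition lower :: "nat \<Rightarrow> nat set \<Rightarrow> nat set" where
  "lower k S = (S - {Suc k}) \<union> ({k} - {0})"

lemma raise_iff_lower:
  assumes "0 \<notin> S" "0 \<notin> T"
  shows "raisable k S \<and> T = raise k S \<longleftrightarrow> lowerable k T \<and> S = lower k T"
  using assms unfolding raisable_def raise_def lowerable_def lower_def by (cases "k = 0") auto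

lemma strict_set_inj:
  assumes "strict \<mu>" "strict \<nu>" "set \<mu> = set \<nu>"
  shows "\<mu> = \<nu>"
proof -
  have "sorted_wrt (<) (rev \<mu>)" "sorted_wrt (<) (rev \<nu>)"
    using assms by (auto simp: strict_def sorted_wrt_rev)
  then have "rev \<mu> = rev \<nu>"
    using assms(3) by (intro strict_sorted_equal) auto
  then show ?thesis by simp
qed

text \<open>\<open>Suc (part \<tau> i)\<close> cannot be a part of \<open>\<tau>\<close>, since it
  would then occur twice in \<open>\<mu>\<close>; the old value disappears because it occurred only
  once.\<close>

lemma raise_of_part:
  assumes "strict \<tau>" "strict \<mu>" and eq: "part \<mu> = (part \<tau>)(i := Suc (part \<tau> i))"
  shows "raisable (part \<tau> i) (set \<tau>) \<and> set \<mu> = raise (part \<tau> i) (set \<tau>)"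
proof -
  have "Suc (part \<tau> i) \<noteq> part \<tau> i'" for i'
    using part_inj[OF assms(2), of i i'] eq by (auto simp: fun_eq_iff split: if_splits) (metis n_not_Suc_n)
  moreover have "part \<tau> i \<noteq> part \<tau> i'" if "i \<noteq> i'" "0 < part \<tau> i'" for i'
    using part_inj[OF assms(1), of i i'] that by auto
  ultimately show ?thesis
    unfolding set_eq_range_part[OF assms(1)] set_eq_range_part[OF assms(2)] raisable_def raise_def eq
    by (auto simp: image_iff split: if_splits) (metis)+
qed

lemma covers_iff_raise:
  assumes "strict \<tau>" "strict \<mu>"
  shows "\<tau> \<nearrow> \<mu> \<longleftrightarrow> (\<exists>k. raisable k (set \<tau>) \<and> set \<mu> = raise k (set \<tau>))"
proof
  assume "\<tau> \<nearrow> \<mu>"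
  then show "\<exists>k. raisable k (set \<tau>) \<and> set \<mu> = raise k (set \<tau>)"
    using raise_of_part[OF assms] by (auto simp: covers_iff_part)
next
  assume "\<exists>k. raisable k (set \<tau>) \<and> set \<mu> = raise k (set \<tau>)"
  then obtain k where k: "raisable k (set \<tau>)" "set \<mu> = raise k (set \<tau>)" by blast
  \<comment> \<open>The row to be enlarged; for \<open>k = 0\<close> it is the first empty row,
    hence the bound with equality.\<close>
  obtain i where i: "part \<tau> i = k" "i \<le> length \<tau>"
  proof (cases "k = 0")
    case True
    then show ?thesis using that[of "length \<tau>"] by (simp add: part_def)
  next
    case False
    then obtain i where "i < length \<tau>" "\<tau> ! i = k"
      using k(1) by (auto simp: raisable_def in_set_conv_nth)
    then show ?thesis using that[of i] by (simp add: part_def)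
  qed
  define p where "p = (part \<tau>)(i := Suc k)"
  have nk: "part \<tau> i' \<noteq> Suc k" for i'
    using k(1) set_eq_range_part[OF assms(1)] by (metis Diff_iff nat.simps(3) raisable_def rangeI singletonD)
  \<comment> \<open>The enlarged sequence still decreases strictly, as \<open>Suc k\<close> is not a
    part of \<open>\<tau>\<close>; a strict partition is determined by its set of parts, so
    \<open>\<rho>\<close> will be \<open>\<mu>\<close>.\<close>
  obtain \<rho> where \<rho>: "strict \<rho>" "part \<rho> = p"
  proof (rule strict_of_part[of p "Suc (length \<tau>)"])
    show "p (Suc (length \<tau>)) = 0"
      using i by (auto simp: p_def part_def)
    show "p (Suc i') < p i' \<or> p i' = 0 \<and> p (Suc i') = 0" for i'
      using part_Suc_less[OF assms(1), of i'] nk[of i'] i part_eq_0_iff[OF assms(1), of i']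
      by (auto simp: p_def)
  qed auto
  have "set \<rho> = set \<mu>"
    using raise_of_part[OF assms(1) \<rho>(1), of i] \<rho>(2) k(2) i by (simp add: p_def)
  then have "\<rho> = \<mu>"
    using strict_set_inj \<rho>(1) assms(2) by blast
  then show "\<tau> \<nearrow> \<mu>"
    using \<rho> assms i by (auto simp: covers_iff_part p_def)
qed

subsection \<open>The commutation relation\<close>

text \<open>The moves involve \<open>{i, i + 1}\<close> and \<open>{j, j + 1}\<close>. If these
  share one number, neither order of the moves is possible; if they are disjoint, the moves do not
  interact.\<close>

lemma raise_lower_commute:
  assumes "i \<noteq> j"
  shows "raisable i S \<and> lowerable j (raise i S) \<longleftrightarrow> lowerable j S \<and> raisable i (lower j S)"
    and "raisable i S \<Longrightarrow> lowerable j (raise i S) \<Longrightarrow> lower j (raise i S) = raise i (lower j S)"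
  using assms unfolding raisable_def raise_def lowerable_def lower_def
  by auto

lemma raise_lower_same:
  assumes "0 \<notin> S"
  shows "raisable i S \<Longrightarrow> lowerable i (raise i S) \<and> lower i (raise i S) = S"
    and "lowerable i S \<Longrightarrow> raisable i (lower i S) \<and> raise i (lower i S) = S"
  using assms unfolding raisable_def raise_def lowerable_def lower_def
  by (cases "i = 0"; auto)+

text \<open>This is 2^(1 + l(\<tau>) - l(\<rho>)) for a cover
  \<open>\<tau> \<nearrow> \<rho>\<close>; the leading factor 2 of the transition probability is
  absorbed here.\<close>

definition raise_weight :: "nat \<Rightarrow> real" where
  "raise_weight k = (if k = 0 then 1 else 2)"

section \<open>Up and down operators on sets of parts\<close>

definition set_up :: "(nat set \<Rightarrow> real) \<Rightarrow> nat set \<Rightarrow> real" where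
  "set_up f S = (\<Sum>k | raisable k S. raise_weight k * f (raise k S))"

definition set_down :: "(nat set \<Rightarrow> real) \<Rightarrow> nat set \<Rightarrow> real" where
  "set_down f S = (\<Sum>k | lowerable k S. f (lower k S))"

lemma set_up_bounded:
  assumes "S \<subseteq> {..<N}" "0 < N"
  shows "set_up f S = (\<Sum>k<N. if raisable k S then raise_weight k * f (raise k S) else 0)"
  using assms unfolding set_up_def
  by (subst sum.inter_filter[symmetric]) (auto simp: raisable_def intro!: sum.cong)

text \<open>The bound is one larger than for \<open>set_up\<close>, because raising a set below
  \<open>N\<close> can produce the element \<open>N\<close>; both sums still run over
  \<open>k < N\<close> and can be interchanged.\<close>

lemma set_down_bounded:
  assumes "S \<subseteq> {..N}"
  shows "set_down f S = (\<Sum>k<N. if lowerable k S then f (lower k S) else 0)"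
  using assms unfolding set_down_def
  by (subst sum.inter_filter[symmetric]) (fastforce simp: lowerable_def intro!: sum.cong)+

text \<open>\<open>[k \<in> S, k+1 \<notin> S] - [k+1 \<in> S, k \<notin> S] = [k \<in> S] - [k+1 \<in> S]\<close>, so the sum telescopes.\<close>

lemma sum_raisable_minus_lowerable:
  assumes "S \<subseteq> {..<N}" "0 < N" "0 \<notin> S"
  shows "(\<Sum>k<N. raise_weight k * (of_bool (raisable k S) - of_bool (lowerable k S))) = 1"
proof -
  have "(\<Sum>k<N. raise_weight k * (of_bool (raisable k S) - of_bool (lowerable k S))) =
      (\<Sum>k<N. of_bool (k = 0) + 2 * (of_bool (k \<in> S) - of_bool (Suc k \<in> S)) :: real)"
    using assms(3) by (intro sum.cong) (auto simp: raise_weight_def raisable_def lowerable_def)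
  also have "\<dots> = 1 + 2 * (of_bool (0 \<in> S) - of_bool (N \<in> S))"
    using \<open>0 < N\<close> sum_lessThan_telescope'[of "\<lambda>k. of_bool (k \<in> S) :: real" N]
    by (simp only: sum.distrib sum_distrib_left[symmetric]) (simp add: of_bool_def sum.delta)
  finally show ?thesis using assms by auto
qed

lemma set_up_set_down:
  assumes "finite S" "0 \<notin> S"
  shows "set_up (set_down f) S = set_down (set_up f) S + f S"
proof -
  obtain N where N: "S \<subseteq> {..<N}" "0 < N"
    using assms(1) unfolding finite_nat_set_iff_bounded
    by (metis gr_zeroI lessThan_iff less_zeroE subsetI zero_less_one)
  have S: "S \<subseteq> {..N}"
    using N(1) by auto
  have up: "raise i S \<subseteq> {..N}" if "i < N" for i
    using N that by (auto simp: raise_def)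
  have down: "lower j S \<subseteq> {..<N}" if "j < N" for j
    using N that by (auto simp: lower_def)
  have "set_up (set_down f) S = (\<Sum>i<N. \<Sum>j<N. if raisable i S \<and> lowerable j (raise i S)
      then raise_weight i * f (lower j (raise i S)) else 0)"
    unfolding set_up_bounded[OF N]
    by (intro sum.cong) (auto simp: set_down_bounded[OF up] sum_distrib_left intro!: sum.cong)
  moreover have "set_down (set_up f) S = (\<Sum>j<N. \<Sum>i<N. if lowerable j S \<and> raisable i (lower j S)
      then raise_weight i * f (raise i (lower j S)) else 0)"
    unfolding set_down_bounded[OF S]
    by (intro sum.cong) (auto simp: set_up_bounded[OF down N(2)] intro!: sum.cong)
  then have "set_down (set_up f) S = (\<Sum>i<N. \<Sum>j<N. if lowerable j S \<and> raisable i (lower j S)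
      then raise_weight i * f (raise i (lower j S)) else 0)"
    by (subst (asm) sum.swap)
  \<comment> \<open>Pairs with \<open>i \<noteq> j\<close> cancel. A diagonal pair returns to
    \<open>S\<close>, in one order when \<open>i\<close> is raisable and in the other when it is
    lowerable.\<close>
  ultimately have "set_up (set_down f) S - set_down (set_up f) S =
     (\<Sum>i<N. \<Sum>j<N. if i = j then raise_weight i * (of_bool (raisable i S) - of_bool (lowerable i S)) * f S else 0)"
    by (simp only: sum_subtractf[symmetric])
       (intro sum.cong refl, use raise_lower_commute[of _ _ S] raise_lower_same[OF assms(2)] in \<open>auto, metis+\<close>)
  also have "\<dots> = (\<Sum>i<N. raise_weight i * (of_bool (raisable i S) - of_bool (lowerable i S))) * f S"
    by (simp add: sum_distrib_right)
  finally show ?thesis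
    using sum_raisable_minus_lowerable[OF N assms(2)] by simp
qed

section \<open>From sets of parts back to partitions\<close>

definition partition_of :: "nat set \<Rightarrow> nat list" where
  "partition_of S = rev (sorted_list_of_set S)"

lemma strict_partition_of:
  "finite S \<Longrightarrow> 0 \<notin> S \<Longrightarrow> strict (partition_of S) \<and> set (partition_of S) = S"
  by (auto simp: strict_def partition_of_def sorted_wrt_rev intro: gr0I)

lemma partition_of_set: "strict \<mu> \<Longrightarrow> partition_of (set \<mu>) = \<mu>"
  using strict_partition_of[of "set \<mu>"] strict_set_inj[of _ \<mu>] by (auto simp: strict_def)

lemma length_eq_card: "strict \<mu> \<Longrightarrow> length \<mu> = card (set \<mu>)"
  using strict_sorted_iff[of "rev \<mu>"] by (auto simp: strict_def sorted_wrt_rev distinct_card)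

definition up_op :: "(nat list \<Rightarrow> real) \<Rightarrow> nat list \<Rightarrow> real" where
  "up_op f \<tau> = (\<Sum>\<rho> | \<tau> \<nearrow> \<rho>. 2 powi (1 + int (length \<tau>) - int (length \<rho>)) * f \<rho>)"

definition down_op :: "(nat list \<Rightarrow> real) \<Rightarrow> nat list \<Rightarrow> real" where
  "down_op f \<mu> = (\<Sum>\<tau> | \<tau> \<nearrow> \<mu>. f \<tau>)"

lemma up_op_eq_set_up:
  assumes "strict \<tau>"
  shows "up_op f \<tau> = set_up (f \<circ> partition_of) (set \<tau>)"
proof -
  let ?S = "set \<tau>"
  have S: "finite ?S" "0 \<notin> ?S" using assms by (auto simp: strict_def)
  have raise: "finite (raise k ?S)" "0 \<notin> raise k ?S" for k
    using S by (auto simp: raise_def)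
  have "bij_betw (\<lambda>k. partition_of (raise k ?S)) {k. raisable k ?S} {\<rho>. \<tau> \<nearrow> \<rho>}"
  proof (rule bij_betw_imageI)
    show "inj_on (\<lambda>k. partition_of (raise k ?S)) {k. raisable k ?S}"
    proof (rule inj_onI)
      fix k k' assume "k \<in> {k. raisable k ?S}" "k' \<in> {k. raisable k ?S}"
        and "partition_of (raise k ?S) = partition_of (raise k' ?S)"
      then have "raisable k ?S" "raisable k' ?S" "raise k ?S = raise k' ?S"
        using strict_partition_of[OF raise] by (auto, metis+)
      \<comment> \<open>\<open>Suc k\<close> is the only element of \<open>raise k ?S\<close>
        outside \<open>?S\<close>, so it determines \<open>k\<close>.\<close>
      then show "k = k'"
        unfolding raisable_def raise_def by (metis Diff_iff insertE insertI1 nat.inject)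
    qed
    show "(\<lambda>k. partition_of (raise k ?S)) ` {k. raisable k ?S} = {\<rho>. \<tau> \<nearrow> \<rho>}"
    proof (intro equalityI subsetI)
      fix \<rho> assume "\<rho> \<in> {\<rho>. \<tau> \<nearrow> \<rho>}"
      then have "strict \<rho>" "\<exists>k. raisable k ?S \<and> set \<rho> = raise k ?S"
        using coversD covers_iff_raise by blast+
      then show "\<rho> \<in> (\<lambda>k. partition_of (raise k ?S)) ` {k. raisable k ?S}"
        by (metis (mono_tags, lifting) imageI mem_Collect_eq partition_of_set)
    next
      fix \<rho> assume "\<rho> \<in> (\<lambda>k. partition_of (raise k ?S)) ` {k. raisable k ?S}"
      then obtain k where "raisable k ?S" "\<rho> = partition_of (raise k ?S)" by blast
      then show "\<rho> \<in> {\<rho>. \<tau> \<nearrow> \<rho>}"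
        using covers_iff_raise[OF assms, of \<rho>] strict_partition_of[OF raise, of k] by auto
    qed
  qed
  then have "up_op f \<tau> = (\<Sum>k | raisable k ?S. 2 powi (1 + int (length \<tau>)
      - int (length (partition_of (raise k ?S)))) * f (partition_of (raise k ?S)))"
    unfolding up_op_def by (rule sum.reindex_bij_betw[symmetric])
  also have "\<dots> = set_up (f \<circ> partition_of) ?S"
    unfolding set_up_def
  proof (rule sum.cong)
    fix k assume "k \<in> {k. raisable k ?S}"
    \<comment> \<open>The number of parts grows exactly when a new row is opened, which turns the
      power of 2 into \<open>raise_weight k\<close>.\<close>
    then have "card (raise k ?S) = card ?S + of_bool (k = 0)"
      using S card_Suc_Diff1[of ?S k] by (auto simp: raisable_def raise_def card_insert_if)
    then show "2 powi (1 + int (length \<tau>) - int (length (partition_of (raise k ?S)))) * f (partition_of (raise k ?S))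
        = raise_weight k * (f \<circ> partition_of) (raise k ?S)"
      using strict_partition_of[OF raise, of k] length_eq_card[OF assms] length_eq_card[of "partition_of (raise k ?S)"]
      by (auto simp: raise_weight_def)
  qed simp
  finally show ?thesis .
qed

lemma down_op_eq_set_down:
  assumes "strict \<mu>"
  shows "down_op f \<mu> = set_down (f \<circ> partition_of) (set \<mu>)"
proof -
  let ?S = "set \<mu>"
  have S: "finite ?S" "0 \<notin> ?S" using assms by (auto simp: strict_def)
  have lower: "finite (lower k ?S)" "0 \<notin> lower k ?S" for k
    using S by (auto simp: lower_def)
  have covers: "\<tau> \<nearrow> \<mu> \<longleftrightarrow> (\<exists>k. lowerable k ?S \<and> set \<tau> = lower k ?S)" if "strict \<tau>" for \<tau>
    using covers_iff_raise[OF that assms] raise_iff_lower[of "set \<tau>" ?S] S that by (auto simp: strict_def)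
  have "bij_betw (\<lambda>k. partition_of (lower k ?S)) {k. lowerable k ?S} {\<tau>. \<tau> \<nearrow> \<mu>}"
  proof (rule bij_betw_imageI)
    show "inj_on (\<lambda>k. partition_of (lower k ?S)) {k. lowerable k ?S}"
    proof (rule inj_onI)
      fix k k' assume "k \<in> {k. lowerable k ?S}" "k' \<in> {k. lowerable k ?S}"
        and "partition_of (lower k ?S) = partition_of (lower k' ?S)"
      then have "lowerable k ?S" "lowerable k' ?S" "lower k ?S = lower k' ?S"
        using strict_partition_of[OF lower] by (auto, metis+)
      \<comment> \<open>\<open>Suc k\<close> is the only element of \<open>?S\<close> that is
        lost.\<close>
      then show "k = k'"
        unfolding lowerable_def lower_def by (metis Diff_iff UnCI UnE insertCI nat.inject singletonD)
    qed
    show "(\<lambda>k. partition_of (lower k ?S)) ` {k. lowerable k ?S} = {\<tau>. \<tau> \<nearrow> \<mu>}"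
    proof (intro equalityI subsetI)
      fix \<tau> assume "\<tau> \<in> {\<tau>. \<tau> \<nearrow> \<mu>}"
      then have "strict \<tau>" "\<exists>k. lowerable k ?S \<and> set \<tau> = lower k ?S"
        using coversD covers by blast+
      then show "\<tau> \<in> (\<lambda>k. partition_of (lower k ?S)) ` {k. lowerable k ?S}"
        by (metis (mono_tags, lifting) imageI mem_Collect_eq partition_of_set)
    next
      fix \<tau> assume "\<tau> \<in> (\<lambda>k. partition_of (lower k ?S)) ` {k. lowerable k ?S}"
      then obtain k where "lowerable k ?S" "\<tau> = partition_of (lower k ?S)" by blast
      then show "\<tau> \<in> {\<tau>. \<tau> \<nearrow> \<mu>}"
        using covers[of \<tau>] strict_partition_of[OF lower, of k] by auto
    qed
  qed
  then have "down_op f \<mu> = (\<Sum>k | lowerable k ?S. f (partition_of (lower k ?S)))"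
    unfolding down_op_def by (rule sum.reindex_bij_betw[symmetric])
  then show ?thesis by (simp add: set_down_def)
qed

lemma up_op_down_op:
  assumes "strict \<mu>"
  shows "up_op (down_op f) \<mu> = down_op (up_op f) \<mu> + f \<mu>"
proof -
  let ?S = "set \<mu>" and ?f = "f \<circ> partition_of"
  have S: "finite ?S" "0 \<notin> ?S" using assms by (auto simp: strict_def)
  have "up_op (down_op f) \<mu> = set_up (set_down ?f) ?S"
    unfolding up_op_eq_set_up[OF assms] set_up_def
    using S by (intro sum.cong) (auto simp: raise_def down_op_eq_set_down strict_partition_of)
  moreover have "down_op (up_op f) \<mu> = set_down (set_up ?f) ?S"
    unfolding down_op_eq_set_down[OF assms] set_down_def
    using S by (intro sum.cong) (auto simp: lower_def up_op_eq_set_up strict_partition_of)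
  ultimately show ?thesis
    using set_up_set_down[OF S, of ?f] partition_of_set[OF assms] by simp
qed

lemma down_op_cong: "(\<And>\<tau>. strict \<tau> \<Longrightarrow> f \<tau> = g \<tau>) \<Longrightarrow> down_op f \<mu> = down_op g \<mu>"
  unfolding down_op_def by (intro sum.cong) (auto dest: coversD)

lemma up_op_cong: "(\<And>\<tau>. strict \<tau> \<Longrightarrow> f \<tau> = g \<tau>) \<Longrightarrow> up_op f \<mu> = up_op g \<mu>"
  unfolding up_op_def by (intro sum.cong) (auto dest: coversD)

subsection \<open>Counting standard shifted tableaux\<close>

text \<open>The box \<open>b\<close> is a corner and its entry exceeds all others, so every
  monotonicity condition that involves \<open>b\<close> holds automatically and the remaining ones
  are those of \<open>\<tau>\<close>.\<close>

lemma insert_mem_standard_shifted_tableaux_iff: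
  assumes cov: "\<tau> \<nearrow> \<mu>" and b: "b \<notin> shifted_diagram \<tau>"
    and diag: "shifted_diagram \<mu> = insert b (shifted_diagram \<tau>)"
    and T: "T b = 0"
  shows "T(b := sum_list \<mu>) \<in> standard_shifted_tableaux \<mu> \<longleftrightarrow> T \<in> standard_shifted_tableaux \<tau>"
proof -
  let ?n = "sum_list \<mu>" and ?D = "shifted_diagram \<tau>" and ?T = "T(b := sum_list \<mu>)"
  note c = coversD[OF cov]
  obtain i j where ij: "b = (i, j)" by (cases b)
  have "i \<le> j" using diag ij mem_shifted_diagram_iff by auto
  have corner: "(i', j') \<notin> ?D" if "i \<le> i'" "j \<le> j'" for i' j'
    using shifted_diagram_order_ideal[of \<tau> i' j' i j] c b ij that \<open>i \<le> j\<close> by blast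
  have bij: "bij_betw ?T (shifted_diagram \<mu>) {1..?n} \<longleftrightarrow> bij_betw T ?D {1..sum_list \<tau>}"
  proof -
    have "bij_betw ?T (insert b ?D) (insert ?n {1..sum_list \<tau>}) \<longleftrightarrow> bij_betw ?T ?D {1..sum_list \<tau>}"
      using notIn_Un_bij_betw3[of b ?D ?T "{1..sum_list \<tau>}"] b c by simp
    also have "\<dots> \<longleftrightarrow> bij_betw T ?D {1..sum_list \<tau>}"
      using b by (intro bij_betw_cong) auto
    also have "insert ?n {1..sum_list \<tau>} = {1..?n}"
      using c by auto
    finally show ?thesis unfolding diag .
  qed
  have less: "T d < ?n" if "bij_betw T ?D {1..sum_list \<tau>}" "d \<in> ?D" for d
    using bij_betwE[OF that(1)] that(2) c by fastforce
  have row: "(\<forall>i j j'. (i, j) \<in> shifted_diagram \<mu> \<and> (i, j') \<in> shifted_diagram \<mu> \<and> j < j'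
          \<longrightarrow> ?T (i, j) < ?T (i, j')) \<longleftrightarrow>
      (\<forall>i j j'. (i, j) \<in> ?D \<and> (i, j') \<in> ?D \<and> j < j' \<longrightarrow> T (i, j) < T (i, j'))" (is "?L \<longleftrightarrow> ?R")
    if "bij_betw T ?D {1..sum_list \<tau>}"
  proof (intro iffI allI impI; elim conjE)
    fix x y z
    assume mono: ?L and d: "(x, y) \<in> ?D" "(x, z) \<in> ?D" "y < z"
    have "(x, y) \<noteq> b" "(x, z) \<noteq> b" using d b by auto
    then show "T (x, y) < T (x, z)"
      using mono[rule_format, of x y z] d diag by simp
  next
    fix x y z
    assume mono: ?R and d: "(x, y) \<in> shifted_diagram \<mu>" "(x, z) \<in> shifted_diagram \<mu>" "y < z"
    have "(x, y) \<noteq> b" using d corner[of x z] diag ij by auto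
    then show "?T (x, y) < ?T (x, z)"
      using mono[rule_format, of x y z] d diag less[OF that, of "(x, y)"] by (cases "(x, z) = b") auto
  qed
  have col: "(\<forall>i i' j. (i, j) \<in> shifted_diagram \<mu> \<and> (i', j) \<in> shifted_diagram \<mu> \<and> i < i'
          \<longrightarrow> ?T (i, j) < ?T (i', j)) \<longleftrightarrow>
      (\<forall>i i' j. (i, j) \<in> ?D \<and> (i', j) \<in> ?D \<and> i < i' \<longrightarrow> T (i, j) < T (i', j))" (is "?L \<longleftrightarrow> ?R")
    if "bij_betw T ?D {1..sum_list \<tau>}"
  proof (intro iffI allI impI; elim conjE)
    fix x y z
    assume mono: ?L and d: "(x, z) \<in> ?D" "(y, z) \<in> ?D" "x < y"
    have "(x, z) \<noteq> b" "(y, z) \<noteq> b" using d b by auto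
    then show "T (x, z) < T (y, z)"
      using mono[rule_format, of x z y] d diag by simp
  next
    fix x y z
    assume mono: ?R and d: "(x, z) \<in> shifted_diagram \<mu>" "(y, z) \<in> shifted_diagram \<mu>" "x < y"
    have "(x, z) \<noteq> b" using d corner[of y z] diag ij by auto
    then show "?T (x, z) < ?T (y, z)"
      using mono[rule_format, of x z y] d diag less[OF that, of "(x, z)"] by (cases "(y, z) = b") auto
  qed
  have zero: "(\<forall>d. d \<notin> shifted_diagram \<mu> \<longrightarrow> ?T d = 0) \<longleftrightarrow> (\<forall>d. d \<notin> ?D \<longrightarrow> T d = 0)"
    using T unfolding diag by (metis fun_upd_apply insert_iff)
  show ?thesis
    unfolding standard_shifted_tableaux_def mem_Collect_eq bij zero using row col by blast
qed

lemma maximal_entry_corner: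
  assumes "strict \<mu>" and T: "T \<in> standard_shifted_tableaux \<mu>"
    and b: "b \<in> shifted_diagram \<mu>" "T b = sum_list \<mu>"
  obtains \<tau> where "\<tau> \<nearrow> \<mu>" "b \<notin> shifted_diagram \<tau>" "shifted_diagram \<mu> = insert b (shifted_diagram \<tau>)"
proof -
  obtain i j where ij: "b = (i, j)" by (cases b)
  have T_le: "T d \<le> T b" if "d \<in> shifted_diagram \<mu>" for d
    using T that b(2) by (auto simp: standard_shifted_tableaux_def dest: bij_betwE)
  have j: "i \<le> j" "j < i + part \<mu> i"
    using b(1) ij by (auto simp: mem_shifted_diagram_iff)
  have right: "T (i, j) < T (i, Suc j)" if "(i, Suc j) \<in> shifted_diagram \<mu>"
    using that T b(1) lessI[of j] unfolding ij standard_shifted_tableaux_def by blast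
  have below: "T (i, j) < T (Suc i, j)" if "(Suc i, j) \<in> shifted_diagram \<mu>"
    using that T b(1) lessI[of i] unfolding ij standard_shifted_tableaux_def by blast
  have "(i, Suc j) \<notin> shifted_diagram \<mu>"
    using T_le[of "(i, Suc j)"] right ij by fastforce
  then have j_eq: "Suc j = i + part \<mu> i"
    using j by (auto simp: mem_shifted_diagram_iff)
  have "(Suc i, j) \<notin> shifted_diagram \<mu>"
    using T_le[of "(Suc i, j)"] below ij by fastforce
  \<comment> \<open>Because of the shift, a nonempty next row that is shorter by exactly one would
    end in the same column, below \<open>b\<close>. So row \<open>i\<close> can lose its last
    box.\<close>
  then have row: "Suc (part \<mu> (Suc i)) < part \<mu> i \<or> part \<mu> (Suc i) = 0"
    using j_eq j part_Suc_less[OF assms(1), of i] by (auto simp: mem_shifted_diagram_iff)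
  define p where "p = (part \<mu>)(i := part \<mu> i - 1)"
  obtain \<tau> where \<tau>: "strict \<tau>" "part \<tau> = p"
  proof (rule strict_of_part[of p "length \<mu>"])
    show "p (length \<mu>) = 0" by (simp add: p_def part_def)
    show "p (Suc i') < p i' \<or> p i' = 0 \<and> p (Suc i') = 0" for i'
      using part_Suc_less[OF assms(1), of i'] row by (auto simp: p_def)
  qed auto
  have eq: "part \<mu> = (part \<tau>)(i := Suc (part \<tau> i))"
    using \<tau> j by (auto simp: p_def)
  have "b = (i, i + part \<tau> i)"
    using ij j_eq j \<tau> by (simp add: p_def)
  then show ?thesis
    using that[of \<tau>] eq shifted_diagram_insert[OF eq] \<tau> assms(1) by (auto simp: covers_iff_part)
qed

text \<open>The branching rule: tableaux are sorted by the box of their largest entry, and deleting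
  that entry leaves a tableau of the smaller shape.\<close>

lemma num_sst_eq_sum_covers:
  assumes "strict \<mu>" "\<mu> \<noteq> []"
  shows "num_sst \<mu> = (\<Sum>\<tau> | \<tau> \<nearrow> \<mu>. num_sst \<tau>)"
proof -
  let ?n = "sum_list \<mu>"
  define V where "V \<tau> = {T \<in> standard_shifted_tableaux \<mu>. \<exists>b. b \<notin> shifted_diagram \<tau> \<and>
      shifted_diagram \<mu> = insert b (shifted_diagram \<tau>) \<and> T b = ?n}" for \<tau>
  have card_V: "card (V \<tau>) = num_sst \<tau>" if cov: "\<tau> \<nearrow> \<mu>" for \<tau>
  proof -
    obtain b where b: "b \<notin> shifted_diagram \<tau>" "shifted_diagram \<mu> = insert b (shifted_diagram \<tau>)"
      using cov by (auto simp: covers_def)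
    have V: "V \<tau> = {T \<in> standard_shifted_tableaux \<mu>. T b = ?n}"
    proof -
      have "b' = b" if "b' \<notin> shifted_diagram \<tau>" "insert b (shifted_diagram \<tau>) = insert b' (shifted_diagram \<tau>)" for b'
        using that b(1) by blast
      then show ?thesis
        using b unfolding V_def by metis
    qed
    note iff = insert_mem_standard_shifted_tableaux_iff[OF cov b]
    have T0: "T b = 0" if "T \<in> standard_shifted_tableaux \<tau>" for T
      using that b(1) by (cases b) (auto simp: standard_shifted_tableaux_def)
    have "bij_betw (\<lambda>T. T(b := ?n)) (standard_shifted_tableaux \<tau>) (V \<tau>)"
      unfolding V
    \<comment> \<open>The inverse resets \<open>b\<close> to 0, the conventional value outside the
      diagram of \<open>\<tau>\<close>.\<close>
    proof (rule bij_betw_byWitness[where f' = "\<lambda>T. T(b := 0)"])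
      show "(\<lambda>T. T(b := 0)) ` {T \<in> standard_shifted_tableaux \<mu>. T b = ?n} \<subseteq> standard_shifted_tableaux \<tau>"
      proof (rule image_subsetI)
        fix T assume "T \<in> {T \<in> standard_shifted_tableaux \<mu>. T b = ?n}"
        then show "T(b := 0) \<in> standard_shifted_tableaux \<tau>" using iff[of "T(b := 0)"] fun_upd_idem[of T b ?n] by simp
      qed
    qed (use iff T0 in auto)
    then show ?thesis by (simp add: bij_betw_same_card num_sst_def)
  qed
  have "standard_shifted_tableaux \<mu> = (\<Union>\<tau>\<in>{\<tau>. \<tau> \<nearrow> \<mu>}. V \<tau>)"
  proof (intro equalityI subsetI)
    fix T assume T: "T \<in> standard_shifted_tableaux \<mu>"
    have "?n \<in> {1..?n}"
      using assms by (cases \<mu>) (auto simp: strict_def)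
    moreover have "T ` shifted_diagram \<mu> = {1..?n}"
      using T by (auto simp: standard_shifted_tableaux_def bij_betw_def)
    ultimately obtain b where b: "b \<in> shifted_diagram \<mu>" "T b = ?n"
      by (metis imageE)
    obtain \<tau> where "\<tau> \<nearrow> \<mu>" "b \<notin> shifted_diagram \<tau>" "shifted_diagram \<mu> = insert b (shifted_diagram \<tau>)"
      using maximal_entry_corner[OF assms(1) T b] .
    then have "\<tau> \<nearrow> \<mu>" "T \<in> V \<tau>"
      using T b(2) unfolding V_def by (auto simp del: split_paired_Ex)
    then show "T \<in> (\<Union>\<tau>\<in>{\<tau>. \<tau> \<nearrow> \<mu>}. V \<tau>)" by blast
  qed (auto simp: V_def)
  \<comment> \<open>The largest entry occurs only once; its box determines the diagram of
    \<open>\<tau>\<close>, hence \<open>\<tau>\<close>.\<close>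
  moreover have "\<forall>\<tau>\<in>{\<tau>. \<tau> \<nearrow> \<mu>}. \<forall>\<tau>'\<in>{\<tau>. \<tau> \<nearrow> \<mu>}. \<tau> \<noteq> \<tau>' \<longrightarrow> V \<tau> \<inter> V \<tau>' = {}"
  proof (intro ballI impI, rule ccontr)
    fix \<tau> \<tau>' assume \<tau>: "\<tau> \<in> {\<tau>. \<tau> \<nearrow> \<mu>}" "\<tau>' \<in> {\<tau>. \<tau> \<nearrow> \<mu>}" "\<tau> \<noteq> \<tau>'" "V \<tau> \<inter> V \<tau>' \<noteq> {}"
    then obtain T b b' where T: "T \<in> standard_shifted_tableaux \<mu>" "T b = ?n" "T b' = ?n"
      and b: "b \<notin> shifted_diagram \<tau>" "shifted_diagram \<mu> = insert b (shifted_diagram \<tau>)"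
        "b' \<notin> shifted_diagram \<tau>'" "shifted_diagram \<mu> = insert b' (shifted_diagram \<tau>')"
      unfolding V_def by blast
    have "inj_on T (shifted_diagram \<mu>)"
      using T by (auto simp: standard_shifted_tableaux_def bij_betw_def)
    then have "b = b'"
      using T b by (metis inj_onD insertI1)
    then have "shifted_diagram \<tau> = shifted_diagram \<tau>'"
      using b insert_ident by metis
    then show False
      using \<tau> shifted_diagram_inj coversD by blast
  qed
  ultimately have "card (standard_shifted_tableaux \<mu>) = (\<Sum>\<tau> | \<tau> \<nearrow> \<mu>. card (V \<tau>))"
    using card_UN_disjoint[of "{\<tau>. \<tau> \<nearrow> \<mu>}" V] finite_covers(1)
      finite_subset[OF _ finite_standard_shifted_tableaux[of \<mu>]]
    by (metis (no_types, lifting) V_def mem_Collect_eq subsetI)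
  then show ?thesis
    using card_V by (simp add: num_sst_def)
qed

subsection \<open>Reversible Markov chains\<close>

locale reversible_chain =
  fixes X :: "'a set" and K :: "'a \<Rightarrow> 'a \<Rightarrow> real" and p :: "'a \<Rightarrow> real"
  assumes finite: "finite X"
    and pos: "x \<in> X \<Longrightarrow> 0 < p x"
    and sum_p: "sum p X = 1"
    and sum_K: "x \<in> X \<Longrightarrow> (\<Sum>y\<in>X. K x y) = 1"
    and reversible: "x \<in> X \<Longrightarrow> y \<in> X \<Longrightarrow> p x * K x y = p y * K y x"
begin

abbreviation "P x r y \<equiv> chain_dist X K x r y"

lemma sum_chain_dist: "x \<in> X \<Longrightarrow> (\<Sum>y\<in>X. P x r y) = 1"
proof (induction r)
  case (Suc r)
  have "(\<Sum>y\<in>X. P x (Suc r) y) = (\<Sum>z\<in>X. \<Sum>y\<in>X. P x r z * K z y)"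
    unfolding chain_dist.simps by (rule sum.swap)
  then show ?case
    using Suc sum_K by (simp add: sum_distrib_left[symmetric])
next
  case 0
  then show ?case
    using finite by (simp add: sum.delta)
qed

lemma chain_dist_add:
  assumes "y \<in> X"
  shows "P x (r + s) y = (\<Sum>z\<in>X. P x r z * P z s y)"
  using assms
proof (induction s arbitrary: y)
  case (Suc s)
  have "P x (r + Suc s) y = (\<Sum>w\<in>X. \<Sum>z\<in>X. P x r z * (P z s w * K w y))"
    using Suc by (simp add: sum_distrib_right mult.assoc)
  then show ?case
    by (subst (asm) sum.swap) (simp add: sum_distrib_left)
next
  case 0
  have "(\<Sum>z\<in>X. P x r z * P z 0 y) = (\<Sum>z\<in>X. if y = z then P x r z else 0)"
    by (intro sum.cong) auto
  then show ?case
    using 0 finite by (simp only: add_0_right sum.delta' if_True)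
qed

text \<open>Reversal turns the last step of a path into the first, whereas \<open>chain_dist\<close>
  appends steps at the end; \<open>chain_dist_add\<close> with a single first step bridges
  this.\<close>

lemma chain_dist_reversible: "x \<in> X \<Longrightarrow> y \<in> X \<Longrightarrow> p x * P x r y = p y * P y r x"
proof (induction r arbitrary: x y)
  case (Suc r)
  have one: "P y (Suc 0) z = K y z" for z
    using Suc.prems finite by (simp add: if_distrib[of "\<lambda>u. u * _"] cong: if_cong)
  have "p x * P x (Suc r) y = (\<Sum>z\<in>X. p x * P x r z * K z y)"
    by (simp add: sum_distrib_left mult.assoc)
  also have "\<dots> = (\<Sum>z\<in>X. P z r x * (p z * K z y))"
    using Suc by (intro sum.cong) auto
  also have "\<dots> = (\<Sum>z\<in>X. P z r x * (p y * K y z))"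
    using Suc.prems reversible by (intro sum.cong) auto
  also have "\<dots> = p y * P y (Suc 0 + r) x"
    unfolding chain_dist_add[OF Suc.prems(1)] one
    by (simp add: sum_distrib_left mult_ac)
  finally show ?case by simp
next
  case 0
  then show ?case by auto
qed

lemma tv_dist_le:
  assumes x: "x \<in> X"
  shows "(2 * tv_dist X (P x r) p)\<^sup>2 \<le> P x (2 * r) x / p x - 1"
proof -
  define s where "s = (\<Sum>y\<in>X. \<bar>P x r y - p y\<bar>)"
  have "2 * s * s = (\<Sum>y\<in>X. 2 * s * \<bar>P x r y - p y\<bar>)"
    unfolding s_def by (simp add: sum_distrib_left)
  \<comment> \<open>Cauchy-Schwarz as a weighted inequality of means: since \<open>p\<close> has
    total mass 1, summing gives 2 s^2 <= chi^2 + s^2.\<close>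
  also have "\<dots> \<le> (\<Sum>y\<in>X. (P x r y - p y)\<^sup>2 / p y + s\<^sup>2 * p y)"
  proof (rule sum_mono)
    fix y assume "y \<in> X"
    then have p: "0 < p y" by (rule pos)
    define u where "u = \<bar>P x r y - p y\<bar>"
    have "0 \<le> (u - s * p y)\<^sup>2 / p y"
      using p by simp
    also have "\<dots> = u\<^sup>2 / p y + s\<^sup>2 * p y - 2 * s * u"
      using p by (simp add: field_simps power2_eq_square)
    finally show "2 * s * \<bar>P x r y - p y\<bar> \<le> (P x r y - p y)\<^sup>2 / p y + s\<^sup>2 * p y"
      by (simp add: u_def)
  qed
  also have "\<dots> = (\<Sum>y\<in>X. (P x r y - p y)\<^sup>2 / p y) + s * s"
    using sum_p by (simp add: sum.distrib sum_distrib_left[symmetric] power2_eq_square)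
  finally have "s\<^sup>2 \<le> (\<Sum>y\<in>X. (P x r y - p y)\<^sup>2 / p y)"
    by (simp add: power2_eq_square)
  also have "(\<Sum>y\<in>X. (P x r y - p y)\<^sup>2 / p y)
      = (\<Sum>y\<in>X. P x r y * P y r x / p x - 2 * P x r y + p y)"
  proof (rule sum.cong)
    fix y assume y: "y \<in> X"
    \<comment> \<open>This makes the quadratic term a path from \<open>x\<close> to \<open>y\<close>
      and back, so the sum over \<open>y\<close> yields \<open>2 * r\<close> steps.\<close>
    have *: "P x r y / p y = P y r x / p x"
      using chain_dist_reversible[OF x y, of r] pos[OF x] pos[OF y] by (simp add: field_simps)
    have "(P x r y - p y)\<^sup>2 / p y = P x r y * (P x r y / p y) - 2 * P x r y + p y"
      using pos[OF y] by (simp add: field_simps power2_eq_square)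
    then show "(P x r y - p y)\<^sup>2 / p y = P x r y * P y r x / p x - 2 * P x r y + p y"
      unfolding * by simp
  qed simp
  also have "\<dots> = P x (r + r) x / p x - 1"
    using sum_chain_dist[OF x] sum_p chain_dist_add[OF x, of x r r]
    by (simp add: sum.distrib sum_subtractf sum_distrib_left[symmetric] sum_divide_distrib[symmetric])
  finally show ?thesis
    by (simp add: tv_dist_def s_def mult_2[of r])
qed

end

subsection \<open>The generating function\<close>

text \<open>Permutations all of whose cycles are odd, each weighted by 2 to the number of cycles minus
  the size, have the exponential generating function
  \<open>exp (2 artanh (x/2)) = (1 + x/2) / (1 - x/2)\<close>; the factor \<open>exp (- x)\<close> removes the fixed points.\<close>

definition odd_cycle_fps :: "real fps" where
  "odd_cycle_fps = Abs_fps (\<lambda>k. if k = 0 then 1 else 2 / 2 ^ k)"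

definition odd_derangement_fps :: "real fps" where
  "odd_derangement_fps = odd_cycle_fps * fps_exp (- 1)"

lemma odd_cycle_fps_eq:
  "(1 - fps_const (1/2) * fps_X) * odd_cycle_fps = 1 + fps_const (1/2) * fps_X"
proof (rule fps_ext)
  fix n
  show "fps_nth ((1 - fps_const (1/2) * fps_X) * odd_cycle_fps) n = fps_nth (1 + fps_const (1/2) * fps_X) n"
    by (cases n rule: nat.exhaust; cases "n - 1")
       (simp_all add: odd_cycle_fps_def left_diff_distrib mult.assoc)
qed

lemma odd_derangement_fps_mult_exp: "odd_derangement_fps * fps_exp 1 = odd_cycle_fps"
  by (simp add: odd_derangement_fps_def mult.assoc fps_exp_add_mult[symmetric])

text \<open>The logarithmic derivative of (1 + x/2) / (1 - x/2) e^(-x) is 1 / (1 - x^2/4) - 1.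
  Cleared of denominators it gives a recurrence with nonnegative coefficients, whereas the product
  with e^(-x) has alternating signs.\<close>

lemma odd_derangement_fps_ode:
  "(1 - fps_const (1/4) * fps_X ^ 2) * fps_deriv odd_derangement_fps
     = fps_const (1/4) * fps_X ^ 2 * odd_derangement_fps"
proof -
  let ?F = odd_derangement_fps and ?h = "fps_const (1/2) :: real fps" and ?G = "fps_exp (- 1) :: real fps"
  have quarter: "fps_const (1/4) = ?h * ?h" and half: "?h + ?h = 1"
    by (simp_all add: fps_eq_iff)
  have F: "(1 - ?h * fps_X) * ?F = (1 + ?h * fps_X) * ?G"
    unfolding odd_derangement_fps_def mult.assoc[symmetric] odd_cycle_fps_eq ..
  have "fps_deriv ((1 - ?h * fps_X) * ?F) = fps_deriv ((1 + ?h * fps_X) * ?G)"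
    using F by simp
  then have F': "(1 - ?h * fps_X) * fps_deriv ?F - ?h * ?F = ?h * ?G - (1 + ?h * fps_X) * ?G"
    by (simp add: algebra_simps flip: fps_const_neg)
  show ?thesis
    unfolding quarter using F F' half by algebra
qed

lemma odd_derangement_fps_nth_0: "fps_nth odd_derangement_fps 0 = 1"
  by (simp add: odd_derangement_fps_def odd_cycle_fps_def)

lemma odd_derangement_fps_nth_1: "fps_nth odd_derangement_fps (Suc 0) = 0"
  using arg_cong[OF odd_derangement_fps_ode, of "\<lambda>f. fps_nth f 0"] by simp

lemma odd_derangement_fps_nth_2: "fps_nth odd_derangement_fps (Suc (Suc 0)) = 0"
  using arg_cong[OF odd_derangement_fps_ode, of "\<lambda>f. fps_nth f 1"]
  by (simp add: left_diff_distrib mult.assoc fps_X_power_mult_nth)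

lemma odd_derangement_fps_nth_rec:
  "real (n + 3) * fps_nth odd_derangement_fps (n + 3) =
     (real (n + 1) * fps_nth odd_derangement_fps (n + 1) + fps_nth odd_derangement_fps n) / 4"
proof -
  let ?E = "fps_nth odd_derangement_fps"
  have "real (n + 3) * ?E (n + 3) - 1/4 * (real (n + 1) * ?E (n + 1)) = 1/4 * ?E n"
    using arg_cong[OF odd_derangement_fps_ode, of "\<lambda>f. fps_nth f (n + 2)"]
    by (simp add: left_diff_distrib mult.assoc fps_X_power_mult_nth numeral_eq_Suc)
  then show ?thesis by simp
qed

lemma odd_derangement_fps_nth_bounds:
  "0 \<le> fps_nth odd_derangement_fps n \<and> fps_nth odd_derangement_fps n \<le> (1/2) ^ n"
proof (induction n rule: less_induct)
  case (less n)
  consider "n = 0" | "n = 1" | "n = 2" | m where "n = m + 3"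
  proof -
    have "n = 0 \<or> n = 1 \<or> n = 2 \<or> n = (n - 3) + 3" by linarith
    then show thesis using that by blast
  qed
  then show ?case
  proof cases
    case 4
    let ?E = "fps_nth odd_derangement_fps"
    have m: "0 \<le> ?E m" "?E m \<le> (1/2) ^ m" "0 \<le> ?E (m + 1)" "?E (m + 1) \<le> (1/2) ^ (m + 1)"
      using less.IH[of m] less.IH[of "m + 1"] 4 by auto
    have "?E n = (real (m + 1) * ?E (m + 1) + ?E m) / 4 / real (m + 3)"
      using odd_derangement_fps_nth_rec[of m] 4 by (simp add: field_simps)
    moreover have "real (m + 1) * ?E (m + 1) + ?E m \<le> real (m + 1) * (1/2) ^ (m + 1) + (1/2) ^ m"
      using m by (intro add_mono mult_left_mono) auto
    \<comment> \<open>The recurrence reproduces the bound exactly: (m+1) / 2^(m+1) + 1 / 2^m = (m+3)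
      / 2^(m+1).\<close>
    then have "(real (m + 1) * ?E (m + 1) + ?E m) / 4 / real (m + 3) \<le> (1/2) ^ n"
      using 4 by (simp add: field_simps power_add)
    ultimately show ?thesis
      using m by auto
  qed (simp_all add: odd_derangement_fps_nth_0 odd_derangement_fps_nth_1 odd_derangement_fps_nth_2 numeral_2_eq_2)
qed

lemma sum_binomial_odd_derangement:
  assumes "0 < n"
  shows "(\<Sum>k\<le>n. real (n choose k) * fact k * fps_nth odd_derangement_fps k) = 2 * fact n / 2 ^ n"
proof -
  have *: "2 / 2 ^ n = (\<Sum>k\<le>n. fps_nth odd_derangement_fps k * (1 / fact (n - k)) :: real)"
    using arg_cong[OF odd_derangement_fps_mult_exp, of "\<lambda>f. fps_nth f n"] assms
    by (simp add: fps_mult_nth odd_cycle_fps_def atLeast0AtMost)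
  have "2 * fact n / 2 ^ n = (\<Sum>k\<le>n. fact n * (fps_nth odd_derangement_fps k * (1 / fact (n - k))) :: real)"
    unfolding sum_distrib_left[symmetric] *[symmetric] by simp
  also have "\<dots> = (\<Sum>k\<le>n. real (n choose k) * fact k * fps_nth odd_derangement_fps k)"
    by (intro sum.cong) (auto simp: binomial_fact)
  finally show ?thesis by simp
qed

subsection \<open>The down-up walk\<close>

abbreviation f_sst :: "nat list \<Rightarrow> real" where
  "f_sst \<mu> \<equiv> real (num_sst \<mu>)"

lemma strict_Nil: "strict []"
  by (simp add: strict_def)

lemma not_covers_Nil: "\<not> \<tau> \<nearrow> []"
  by (auto dest: coversD)

lemma num_sst_Nil: "num_sst [] = 1"
proof -
  have "standard_shifted_tableaux [] = {\<lambda>_. 0}"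
    by (auto simp: standard_shifted_tableaux_def shifted_diagram_def bij_betw_def)
  then show ?thesis by (simp add: num_sst_def)
qed

lemma down_op_num_sst: "strict \<mu> \<Longrightarrow> \<mu> \<noteq> [] \<Longrightarrow> down_op f_sst \<mu> = f_sst \<mu>"
  by (simp add: down_op_def num_sst_eq_sum_covers)

lemma up_op_Nil: "up_op f [] = f [1]"
proof -
  have "{k. raisable k {}} = {0}" by (auto simp: raisable_def)
  moreover have "partition_of (raise 0 {}) = [1]"
    by (simp add: raise_def partition_of_def)
  ultimately show ?thesis
    by (simp add: up_op_eq_set_up[OF strict_Nil] set_up_def raise_weight_def)
qed

text \<open>D fixes \<open>f_sst\<close> on nonempty partitions, and every cover is nonempty. So U f
  = U D f = D U f + f, and each box contributes 1 to the eigenvalue.\<close>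

lemma up_op_num_sst: "strict \<mu> \<Longrightarrow> up_op f_sst \<mu> = (real (sum_list \<mu>) + 1) * f_sst \<mu>"
proof (induction "sum_list \<mu>" arbitrary: \<mu>)
  case 0
  then have "\<mu> = []" by (cases \<mu>) (auto simp: strict_def)
  have "f_sst [1] = down_op f_sst [1]"
    by (simp add: down_op_num_sst strict_def)
  also have "\<dots> = f_sst []"
  proof -
    have "up_op (down_op f_sst) [] = f_sst []"
      using up_op_down_op[OF strict_Nil, of f_sst] by (simp add: down_op_def not_covers_Nil)
    then show ?thesis by (simp add: up_op_Nil)
  qed
  finally show ?case by (simp add: \<open>\<mu> = []\<close> up_op_Nil)
next
  case (Suc n)
  then have "\<mu> \<noteq> []" by auto
  have "up_op f_sst \<mu> = up_op (down_op f_sst) \<mu>"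
    unfolding up_op_def
  proof (rule sum.cong)
    fix \<rho> assume "\<rho> \<in> {\<rho>. \<mu> \<nearrow> \<rho>}"
    then have "strict \<rho>" "\<rho> \<noteq> []" using coversD not_covers_Nil by auto
    then show "2 powi (1 + int (length \<mu>) - int (length \<rho>)) * f_sst \<rho>
        = 2 powi (1 + int (length \<mu>) - int (length \<rho>)) * down_op f_sst \<rho>"
      by (simp add: down_op_num_sst)
  qed simp
  also have "\<dots> = down_op (up_op f_sst) \<mu> + f_sst \<mu>"
    using Suc.prems by (rule up_op_down_op)
  also have "down_op (up_op f_sst) \<mu> = (\<Sum>\<tau> | \<tau> \<nearrow> \<mu>. real (Suc n) * f_sst \<tau>)"
    unfolding down_op_def
    using Suc.hyps coversD by (intro sum.cong) (force simp: algebra_simps)+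
  also have "\<dots> = real (Suc n) * f_sst \<mu>"
    using down_op_num_sst[OF Suc.prems \<open>\<mu> \<noteq> []\<close>] by (simp add: down_op_def sum_distrib_left[symmetric])
  finally show ?case
    using Suc.hyps(2) by (simp add: algebra_simps)
qed

lemma covers_iff_lower:
  assumes "strict \<tau>" "strict \<mu>"
  shows "\<tau> \<nearrow> \<mu> \<longleftrightarrow> (\<exists>k. lowerable k (set \<mu>) \<and> set \<tau> = lower k (set \<mu>))"
  using covers_iff_raise[OF assms] raise_iff_lower[of "set \<tau>" "set \<mu>"] assms by (auto simp: strict_def)

lemma covers_exists:
  assumes "strict \<mu>" "\<mu> \<noteq> []"
  obtains \<tau> where "\<tau> \<nearrow> \<mu>"
proof -
  let ?S = "set \<mu>"
  have Min: "0 < Min ?S" "Min ?S \<in> ?S"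
    using assms by (auto simp: strict_def)
  \<comment> \<open>Decreasing the smallest part cannot collide with another part.\<close>
  have low: "lowerable (Min ?S - 1) ?S"
    using Min Min_le[of ?S "Min ?S - 1"] by (auto simp: lowerable_def simp del: Min_le)
  have "finite (lower k ?S) \<and> 0 \<notin> lower k ?S" for k
    using assms by (auto simp: lower_def strict_def)
  then have "strict (partition_of (lower (Min ?S - 1) ?S))"
      "set (partition_of (lower (Min ?S - 1) ?S)) = lower (Min ?S - 1) ?S"
    using strict_partition_of by auto
  then show ?thesis
    using that covers_iff_lower assms(1) low by blast
qed

lemma num_sst_pos: "strict \<mu> \<Longrightarrow> 0 < num_sst \<mu>"
proof (induction "sum_list \<mu>" arbitrary: \<mu> rule: less_induct)
  case less
  show ?case
  proof (cases "\<mu> = []")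
    case False
    then obtain \<tau> where \<tau>: "\<tau> \<nearrow> \<mu>" using covers_exists less.prems by blast
    then have "0 < num_sst \<tau>" using less.hyps[of \<tau>] coversD[OF \<tau>] by simp
    then show ?thesis
      unfolding num_sst_eq_sum_covers[OF less.prems False]
      using \<tau> finite_covers(1)[of \<mu>] by (intro sum_pos2[of _ \<tau>]) auto
  qed (simp add: num_sst_Nil)
qed

lemma length_le_sum_list: "strict \<mu> \<Longrightarrow> length \<mu> \<le> sum_list \<mu>"
proof -
  have "length xs \<le> sum_list xs" if "\<forall>k\<in>set xs. 0 < k" for xs :: "nat list"
    using that by (induction xs) auto
  then show "strict \<mu> \<Longrightarrow> length \<mu> \<le> sum_list \<mu>" by (simp add: strict_def)
qed

section \<open>Plancherel measure and transition operator\<close>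

lemma shifted_plancherel_powi:
  assumes "\<mu> \<in> DP n"
  shows "shifted_plancherel n \<mu> = 2 powi (int n - int (length \<mu>)) * (f_sst \<mu>)\<^sup>2 / fact n"
proof -
  have "length \<mu> \<le> n" using assms length_le_sum_list by (auto simp: mem_DP_iff)
  then have "int n - int (length \<mu>) = int (n - length \<mu>)" by simp
  then show ?thesis by (simp only: shifted_plancherel_def power_int_of_nat)
qed

lemma sum_shifted_plancherel: "sum (shifted_plancherel n) (DP n) = 1"
proof -
  have "(\<Sum>\<mu>\<in>DP n. 2 powi (int n - int (length \<mu>)) * (f_sst \<mu>)\<^sup>2) = fact n"
  proof (induction n)
    case 0
    have "DP 0 = {[]}"
      by (auto simp: DP_def) (metis list.set_intros(1) neq_Nil_conv less_numeral_extra(3))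
    then show ?case by (simp add: num_sst_Nil)
  next
    case (Suc n)
    \<comment> \<open>One of the two factors \<open>f_sst \<mu>\<close> is expanded by the branching
      rule; after interchanging the sums the other is summed by U, whose eigenvalue supplies
      \<open>Suc n\<close>.\<close>
    have "(\<Sum>\<mu>\<in>DP (Suc n). 2 powi (int (Suc n) - int (length \<mu>)) * (f_sst \<mu>)\<^sup>2)
        = (\<Sum>\<mu>\<in>DP (Suc n). \<Sum>\<tau>\<in>{\<tau>\<in>DP n. \<tau> \<nearrow> \<mu>}.
             2 powi (int (Suc n) - int (length \<mu>)) * f_sst \<mu> * f_sst \<tau>)"
    proof (rule sum.cong)
      fix \<mu> assume "\<mu> \<in> DP (Suc n)"
      then have \<mu>: "strict \<mu>" "\<mu> \<noteq> []" "{\<tau>. \<tau> \<nearrow> \<mu>} = {\<tau>\<in>DP n. \<tau> \<nearrow> \<mu>}"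
        by (auto simp: mem_DP_iff dest: coversD)
      show "2 powi (int (Suc n) - int (length \<mu>)) * (f_sst \<mu>)\<^sup>2 = (\<Sum>\<tau>\<in>{\<tau>\<in>DP n. \<tau> \<nearrow> \<mu>}.
             2 powi (int (Suc n) - int (length \<mu>)) * f_sst \<mu> * f_sst \<tau>)"
        unfolding sum_distrib_left[symmetric] \<mu>(3)[symmetric]
        using down_op_num_sst[OF \<mu>(1,2)] by (simp add: down_op_def power2_eq_square)
    qed simp
    also have "\<dots> = (\<Sum>\<tau>\<in>DP n. \<Sum>\<mu>\<in>{\<mu>\<in>DP (Suc n). \<tau> \<nearrow> \<mu>}.
        2 powi (int (Suc n) - int (length \<mu>)) * f_sst \<mu> * f_sst \<tau>)"
      by (rule sum.swap_restrict) (rule finite_DP)+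
    also have "\<dots> = (\<Sum>\<tau>\<in>DP n. real (Suc n) * (2 powi (int n - int (length \<tau>)) * (f_sst \<tau>)\<^sup>2))"
    proof (rule sum.cong)
      fix \<tau> assume \<tau>: "\<tau> \<in> DP n"
      then have eq: "{\<mu>\<in>DP (Suc n). \<tau> \<nearrow> \<mu>} = {\<mu>. \<tau> \<nearrow> \<mu>}"
        by (auto simp: mem_DP_iff dest: coversD)
      have "2 powi (int (Suc n) - int (length \<mu>)) =
          (2 powi (int n - int (length \<tau>)) * 2 powi (1 + int (length \<tau>) - int (length \<mu>)) :: real)" for \<mu>
        by (simp add: power_int_add[symmetric] algebra_simps)
      then have "(\<Sum>\<mu>\<in>{\<mu>\<in>DP (Suc n). \<tau> \<nearrow> \<mu>}. 2 powi (int (Suc n) - int (length \<mu>)) * f_sst \<mu> * f_sst \<tau>)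
          = 2 powi (int n - int (length \<tau>)) * f_sst \<tau> * up_op f_sst \<tau>"
        unfolding eq up_op_def sum_distrib_left by (intro sum.cong) (auto simp: mult_ac)
      then show "(\<Sum>\<mu>\<in>{\<mu>\<in>DP (Suc n). \<tau> \<nearrow> \<mu>}. 2 powi (int (Suc n) - int (length \<mu>)) * f_sst \<mu> * f_sst \<tau>)
          = real (Suc n) * (2 powi (int n - int (length \<tau>)) * (f_sst \<tau>)\<^sup>2)"
        using up_op_num_sst[of \<tau>] \<tau> by (simp add: mem_DP_iff power2_eq_square algebra_simps)
    qed simp
    also have "\<dots> = fact (Suc n)"
      unfolding sum_distrib_left[symmetric] Suc.IH by simp
    finally show ?case .
  qed
  then show ?thesis
    by (simp add: shifted_plancherel_powi sum_divide_distrib[symmetric] cong: sum.cong)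
qed

text \<open>The transition operator is D U / n conjugated by multiplication with
  \<open>f_sst\<close>.\<close>

lemma sum_down_up:
  assumes "n \<ge> 1" "\<mu> \<in> DP n"
  shows "(\<Sum>\<rho>\<in>DP n. down_up n \<mu> \<rho> * f \<rho>)
     = down_op (up_op (\<lambda>\<rho>. f_sst \<rho> * f \<rho>)) \<mu> / (real n * f_sst \<mu>)"
proof -
  let ?w = "\<lambda>\<tau> \<rho>. 2 powi (1 + int (length \<tau>) - int (length \<rho>)) * (f_sst \<rho> * f \<rho>) / (real n * f_sst \<mu>)"
  have w: "2 powi (1 + int (length \<tau>) - int (length \<rho>)) =
      (2 * 2 powi (int (length \<tau>) - int (length \<rho>)) :: real)" for \<tau> \<rho> :: "nat list"
    by (simp add: power_int_add[of 2 1, simplified] add_diff_eq[symmetric])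
  have "(\<Sum>\<rho>\<in>DP n. down_up n \<mu> \<rho> * f \<rho>) = (\<Sum>\<rho>\<in>DP n. \<Sum>\<tau>\<in>{\<tau>\<in>{\<tau>. \<tau> \<nearrow> \<mu>}. \<tau> \<nearrow> \<rho>}. ?w \<tau> \<rho>)"
  proof (rule sum.cong)
    fix \<rho> assume "\<rho> \<in> DP n"
    have "{\<tau>. \<tau> \<in> DP (n - 1) \<and> \<tau> \<nearrow> \<mu> \<and> \<tau> \<nearrow> \<rho>} = {\<tau>\<in>{\<tau>. \<tau> \<nearrow> \<mu>}. \<tau> \<nearrow> \<rho>}"
      using assms by (auto simp: mem_DP_iff dest: coversD)
    then show "down_up n \<mu> \<rho> * f \<rho> = (\<Sum>\<tau>\<in>{\<tau>\<in>{\<tau>. \<tau> \<nearrow> \<mu>}. \<tau> \<nearrow> \<rho>}. ?w \<tau> \<rho>)"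
      unfolding down_up_def w by (simp add: sum_distrib_left sum_distrib_right mult_ac)
  qed simp
  also have "\<dots> = (\<Sum>\<tau> | \<tau> \<nearrow> \<mu>. \<Sum>\<rho>\<in>{\<rho>\<in>DP n. \<tau> \<nearrow> \<rho>}. ?w \<tau> \<rho>)"
    by (rule sum.swap_restrict[OF finite_DP finite_covers(1)])
  also have "\<dots> = (\<Sum>\<tau> | \<tau> \<nearrow> \<mu>. up_op (\<lambda>\<rho>. f_sst \<rho> * f \<rho>) \<tau> / (real n * f_sst \<mu>))"
  proof (rule sum.cong)
    fix \<tau> assume "\<tau> \<in> {\<tau>. \<tau> \<nearrow> \<mu>}"
    then have "{\<rho>\<in>DP n. \<tau> \<nearrow> \<rho>} = {\<rho>. \<tau> \<nearrow> \<rho>}"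
      using assms by (fastforce simp: mem_DP_iff dest: coversD)
    then show "(\<Sum>\<rho>\<in>{\<rho>\<in>DP n. \<tau> \<nearrow> \<rho>}. ?w \<tau> \<rho>) = up_op (\<lambda>\<rho>. f_sst \<rho> * f \<rho>) \<tau> / (real n * f_sst \<mu>)"
      by (simp add: up_op_def sum_divide_distrib)
  qed simp
  finally show ?thesis by (simp add: down_op_def sum_divide_distrib)
qed

lemma reversible_chain_down_up:
  assumes "n \<ge> 1"
  shows "reversible_chain (DP n) (down_up n) (shifted_plancherel n)"
proof
  fix \<mu> assume \<mu>: "\<mu> \<in> DP n"
  then have pos: "0 < f_sst \<mu>" by (simp add: mem_DP_iff num_sst_pos)
  then show "0 < shifted_plancherel n \<mu>"
    by (simp add: shifted_plancherel_def)
  have s: "strict \<mu>" "\<mu> \<noteq> []" "sum_list \<mu> = n"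
    using \<mu> assms by (auto simp: mem_DP_iff)
  have "down_op (up_op f_sst) \<mu> = (\<Sum>\<tau> | \<tau> \<nearrow> \<mu>. real n * f_sst \<tau>)"
    unfolding down_op_def using s up_op_num_sst by (intro sum.cong) (auto dest!: coversD simp: algebra_simps)
  also have "\<dots> = real n * f_sst \<mu>"
    using down_op_num_sst[OF s(1,2)] by (simp add: down_op_def sum_distrib_left[symmetric])
  finally show "(\<Sum>\<rho>\<in>DP n. down_up n \<mu> \<rho>) = 1"
    using sum_down_up[OF assms \<mu>, of "\<lambda>_. 1"] pos assms by simp
  fix \<rho> assume \<rho>: "\<rho> \<in> DP n"
  then have pos': "0 < f_sst \<rho>" by (simp add: mem_DP_iff num_sst_pos)
  \<comment> \<open>Merging the power of 2 in the measure with that in the transition probability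
    leaves an expression symmetric in \<open>\<alpha>\<close> and \<open>\<beta>\<close>.\<close>
  define Q where "Q \<alpha> \<beta> = (\<Sum>\<tau> | \<tau> \<in> DP (n - 1) \<and> \<tau> \<nearrow> \<alpha> \<and> \<tau> \<nearrow> \<beta>.
      2 powi (int n + int (length \<tau>) - int (length \<alpha>) - int (length \<beta>)) :: real)" for \<alpha> \<beta>
  have eq: "shifted_plancherel n \<alpha> * down_up n \<alpha> \<beta> = 2 * f_sst \<alpha> * f_sst \<beta> / (real n * fact n) * Q \<alpha> \<beta>"
    if "\<alpha> \<in> DP n" "0 < f_sst \<alpha>" for \<alpha> \<beta>
  proof -
    have "2 powi (int n + int (length \<tau>) - int (length \<alpha>) - int (length \<beta>)) =
        (2 powi (int n - int (length \<alpha>)) * 2 powi (int (length \<tau>) - int (length \<beta>)) :: real)" for \<tau> :: "nat list"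
      by (simp add: power_int_add[symmetric] algebra_simps)
    then have "Q \<alpha> \<beta> = 2 powi (int n - int (length \<alpha>)) *
        (\<Sum>\<tau> | \<tau> \<in> DP (n - 1) \<and> \<tau> \<nearrow> \<alpha> \<and> \<tau> \<nearrow> \<beta>. 2 powi (int (length \<tau>) - int (length \<beta>)))"
      unfolding Q_def sum_distrib_left by simp
    then show ?thesis
      using that(2) by (simp add: shifted_plancherel_powi[OF that(1)] down_up_def power2_eq_square field_simps)
  qed
  have "Q \<mu> \<rho> = Q \<rho> \<mu>"
    unfolding Q_def by (intro sum.cong) (auto simp: algebra_simps)
  then show "shifted_plancherel n \<mu> * down_up n \<mu> \<rho> = shifted_plancherel n \<rho> * down_up n \<rho> \<mu>"
    using eq[OF \<mu> pos, of \<rho>] eq[OF \<rho> pos', of \<mu>] by (simp add: mult_ac)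
qed (rule finite_DP, rule sum_shifted_plancherel)

subsection \<open>Returning to the one-row partition\<close>

definition row :: "nat \<Rightarrow> nat list" where
  "row n = (if n = 0 then [] else [n])"

lemma strict_row: "strict (row n)"
  by (simp add: row_def strict_def)

lemma covers_row_iff: "\<tau> \<nearrow> row (Suc n) \<longleftrightarrow> \<tau> = row n"
proof -
  have low: "lowerable k {Suc n} \<longleftrightarrow> k = n" for k
    by (auto simp: lowerable_def)
  have "\<tau> \<nearrow> row (Suc n) \<longleftrightarrow> set \<tau> = set (row n)" if "strict \<tau>"
    using covers_iff_lower[OF that strict_row, of "Suc n"] by (auto simp: row_def low lower_def)
  then show ?thesis
    using coversD strict_set_inj strict_row by metis
qed

lemma down_op_row: "down_op f (row (Suc n)) = f (row n)"
  by (simp add: down_op_def covers_row_iff)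

text \<open>Only \<open>row n\<close> is covered by \<open>row (Suc n)\<close>, so U maps indicators
  of rows to multiples of such; this keeps the return probability within the one-row
  partitions.\<close>

lemma up_op_indicator_row:
  "up_op (\<lambda>\<rho>. of_bool (\<rho> = row (Suc n))) \<tau> = raise_weight n * of_bool (\<tau> = row n)"
proof -
  have "up_op (\<lambda>\<rho>. of_bool (\<rho> = row (Suc n))) \<tau>
      = (\<Sum>\<rho> | \<tau> \<nearrow> \<rho>. if \<rho> = row (Suc n) then 2 powi (1 + int (length \<tau>) - int (length \<rho>)) else 0)"
    unfolding up_op_def by (intro sum.cong) auto
  also have "\<dots> = raise_weight n * of_bool (\<tau> = row n)"
    using finite_covers(2)[of \<tau>] by (simp add: sum.delta covers_row_iff) (simp add: row_def raise_weight_def)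
  finally show ?thesis .
qed

section \<open>Powers of D U + t\<close>

definition shift_op :: "real \<Rightarrow> (nat list \<Rightarrow> real) \<Rightarrow> nat list \<Rightarrow> real" where
  "shift_op t f \<mu> = down_op (up_op f) \<mu> + t * f \<mu>"

lemma down_op_linear:
  "down_op (\<lambda>\<mu>. a * f \<mu> + b * g \<mu>) = (\<lambda>\<mu>. a * down_op f \<mu> + b * down_op g \<mu>)"
  by (simp add: fun_eq_iff down_op_def sum.distrib sum_distrib_left)

lemma up_op_linear: "up_op (\<lambda>\<mu>. a * f \<mu> + b * g \<mu>) = (\<lambda>\<mu>. a * up_op f \<mu> + b * up_op g \<mu>)"
  by (simp add: fun_eq_iff up_op_def sum.distrib sum_distrib_left algebra_simps)

lemma shift_op_linear:
  "shift_op t (\<lambda>\<mu>. a * f \<mu> + b * g \<mu>) = (\<lambda>\<mu>. a * shift_op t f \<mu> + b * shift_op t g \<mu>)"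
  by (simp add: fun_eq_iff shift_op_def up_op_linear down_op_linear algebra_simps)

lemma shift_op_power_linear:
  "(shift_op t ^^ s) (\<lambda>\<mu>. a * f \<mu> + b * g \<mu>) = (\<lambda>\<mu>. a * (shift_op t ^^ s) f \<mu> + b * (shift_op t ^^ s) g \<mu>)"
  by (induction s) (simp_all add: shift_op_linear)

lemma shift_op_power_scale:
  "(shift_op t ^^ s) (\<lambda>\<mu>. a * f \<mu>) = (\<lambda>\<mu>. a * (shift_op t ^^ s) f \<mu>)"
  using shift_op_power_linear[where b = 0 and g = f] by simp

text \<open>One application of the commutation relation: (D U + t) D = D (U D + t) = D (D U + t +
  1).\<close>

lemma shift_op_power_down_op:
  "strict \<mu> \<Longrightarrow> (shift_op t ^^ s) (down_op f) \<mu> = down_op ((shift_op (t + 1) ^^ s) f) \<mu>"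
proof (induction s arbitrary: \<mu>)
  case (Suc s)
  let ?h = "(shift_op (t + 1) ^^ s) f"
  let ?g = "(shift_op t ^^ s) (down_op f)"
  have "(shift_op t ^^ Suc s) (down_op f) \<mu> = down_op (up_op ?g) \<mu> + t * ?g \<mu>"
    by (simp add: shift_op_def[of t ?g])
  also have "\<dots> = down_op (up_op (down_op ?h)) \<mu> + t * down_op ?h \<mu>"
  proof -
    have "up_op ?g = up_op (down_op ?h)"
      by (rule ext, rule up_op_cong) (rule Suc.IH)
    then show ?thesis using Suc by simp
  qed
  also have "\<dots> = down_op (\<lambda>\<tau>. 1 * up_op (down_op ?h) \<tau> + t * ?h \<tau>) \<mu>"
    unfolding down_op_linear by simp
  also have "\<dots> = down_op (shift_op (t + 1) ?h) \<mu>"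
    by (rule down_op_cong) (simp add: up_op_down_op shift_op_def algebra_simps)
  finally show ?case by simp
qed simp

text \<open>Splitting off one factor lowers \<open>n\<close> by 1 and raises the shift \<open>t\<close> by 1.\<close>

lemma shift_op_power_row:
  "(shift_op t ^^ s) (\<lambda>\<mu>. of_bool (\<mu> = row n)) (row n) * (if n = 0 then 1 else 2 * fact n / 2 ^ n)
    = (\<Sum>k\<le>n. real (n choose k) * fact k * fps_nth odd_derangement_fps k * (real (n - k) + t) ^ s)"
proof (induction n arbitrary: s t)
  case 0
  \<comment> \<open>The empty partition covers nothing, so D U vanishes there.\<close>
  have "(shift_op t ^^ s) f [] = t ^ s * f []" for f
    by (induction s) (simp_all add: shift_op_def down_op_def not_covers_Nil)
  then show ?case
    by (simp add: row_def odd_derangement_fps_nth_0)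
next
  case (Suc n)
  let ?\<delta> = "\<lambda>n \<mu>. of_bool (\<mu> = row n) :: real" and ?E = "fps_nth odd_derangement_fps"
  note outer = Suc.IH
  \<comment> \<open>The reciprocal of the Plancherel weight of \<open>row n\<close>; the exception
    at 0 matches the exception in \<open>raise_weight\<close>.\<close>
  let ?h = "\<lambda>n. if n = 0 then 1 else 2 * fact n / 2 ^ n :: real"
  show ?case
  \<comment> \<open>The recurrence needs \<open>n\<close> at \<open>t + 1\<close> from the outer
    induction and \<open>Suc n\<close> at \<open>t\<close> from this one, both with one power
    less.\<close>
  proof (induction s arbitrary: t)
    case 0
    then show ?case
      by (simp add: sum_binomial_odd_derangement del: sum.atMost_Suc binomial_Suc_Suc)
  next
    case (Suc s)
    have "(shift_op t ^^ Suc s) (?\<delta> (Suc n)) (row (Suc n))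
        = (shift_op t ^^ s) (\<lambda>\<mu>. 1 * down_op (up_op (?\<delta> (Suc n))) \<mu> + t * ?\<delta> (Suc n) \<mu>) (row (Suc n))"
      by (simp only: funpow_Suc_right o_apply shift_op_def[abs_def]) simp
    also have "\<dots> = (shift_op t ^^ s) (down_op (up_op (?\<delta> (Suc n)))) (row (Suc n))
        + t * (shift_op t ^^ s) (?\<delta> (Suc n)) (row (Suc n))"
      unfolding shift_op_power_linear by simp
    also have "(shift_op t ^^ s) (down_op (up_op (?\<delta> (Suc n)))) (row (Suc n))
        = (shift_op (t + 1) ^^ s) (up_op (?\<delta> (Suc n))) (row n)"
      by (simp add: shift_op_power_down_op strict_row down_op_row)
    also have "\<dots> = raise_weight n * (shift_op (t + 1) ^^ s) (?\<delta> n) (row n)"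
      unfolding up_op_indicator_row[abs_def] shift_op_power_scale ..
    finally have step: "(shift_op t ^^ Suc s) (?\<delta> (Suc n)) (row (Suc n))
        = raise_weight n * (shift_op (t + 1) ^^ s) (?\<delta> n) (row n)
          + t * (shift_op t ^^ s) (?\<delta> (Suc n)) (row (Suc n))" .
    have weight: "raise_weight n * ?h (Suc n) = real (Suc n) * ?h n"
      by (simp add: raise_weight_def field_simps)
    have "(w * y + t * z) * H = real (Suc n) * (y * H') + t * (z * H)"
      if "w * H = real (Suc n) * H'" for w y z H H' :: real
      using that by algebra
    from this[OF weight] have rec: "(shift_op t ^^ Suc s) (?\<delta> (Suc n)) (row (Suc n)) * ?h (Suc n)
        = real (Suc n) * ((shift_op (t + 1) ^^ s) (?\<delta> n) (row n) * ?h n)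
          + t * ((shift_op t ^^ s) (?\<delta> (Suc n)) (row (Suc n)) * ?h (Suc n))"
      unfolding step .
    have binom: "real (Suc n choose k) * real (Suc n - k) = real (Suc n) * real (n choose k)" for k
      using binomial_absorb_comp[of "Suc n" k] by (metis diff_Suc_1 mult.commute of_nat_mult)
    \<comment> \<open>One factor \<open>real (Suc n - k) + t\<close> is split off. Its first part
      kills the term \<open>k = Suc n\<close> and turns \<open>Suc n choose k\<close> into
      \<open>n choose k\<close> by absorption.\<close>
    have "(\<Sum>k\<le>Suc n. real (Suc n choose k) * fact k * ?E k * (real (Suc n - k) + t) ^ Suc s)
        = (\<Sum>k\<le>Suc n. (real (Suc n choose k) * real (Suc n - k)) * fact k * ?E k * (real (Suc n - k) + t) ^ s)
          + t * (\<Sum>k\<le>Suc n. real (Suc n choose k) * fact k * ?E k * (real (Suc n - k) + t) ^ s)"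
      unfolding sum_distrib_left sum.distrib[symmetric]
      by (intro sum.cong refl) (simp add: algebra_simps del: binomial_Suc_Suc)
    also have "(\<Sum>k\<le>Suc n. (real (Suc n choose k) * real (Suc n - k)) * fact k * ?E k * (real (Suc n - k) + t) ^ s)
        = (\<Sum>k\<le>n. (real (Suc n choose k) * real (Suc n - k)) * fact k * ?E k * (real (Suc n - k) + t) ^ s)"
      by simp
    also have "\<dots> = real (Suc n) * (\<Sum>k\<le>n. real (n choose k) * fact k * ?E k * (real (n - k) + (t + 1)) ^ s)"
      unfolding binom sum_distrib_left by (intro sum.cong refl) (simp add: Suc_diff_le algebra_simps)
    finally show ?case
      unfolding rec Suc.IH outer by (simp only:)
  qed
qed

text \<open>In the iterated conjugation the inner factors \<open>f_sst\<close> cancel, leaving the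
  plain power of D U.\<close>

lemma sum_chain_dist_down_up:
  assumes "n \<ge> 1" "\<mu> \<in> DP n"
  shows "(\<Sum>\<rho>\<in>DP n. chain_dist (DP n) (down_up n) \<mu> s \<rho> * f \<rho>)
     = (shift_op 0 ^^ s) (\<lambda>\<rho>. f_sst \<rho> * f \<rho>) \<mu> / (real n ^ s * f_sst \<mu>)"
proof (induction s arbitrary: f)
  case 0
  then show ?case
    using assms(2) num_sst_pos[of \<mu>]
    by (simp add: mem_DP_iff[of \<mu>] finite_DP if_distrib[of "\<lambda>u. u * _"] cong: if_cong)
next
  case (Suc s)
  let ?P = "chain_dist (DP n) (down_up n) \<mu>"
  let ?f = "\<lambda>z. down_op (up_op (\<lambda>\<rho>. f_sst \<rho> * f \<rho>)) z / (real n * f_sst z)"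
  have "(\<Sum>\<rho>\<in>DP n. ?P (Suc s) \<rho> * f \<rho>) = (\<Sum>z\<in>DP n. ?P s z * (\<Sum>\<rho>\<in>DP n. down_up n z \<rho> * f \<rho>))"
    by (simp add: sum_distrib_left sum_distrib_right mult.assoc) (rule sum.swap)
  also have "\<dots> = (\<Sum>z\<in>DP n. ?P s z * ?f z)"
    using sum_down_up[OF assms(1)] by (intro sum.cong) auto
  also have "\<dots> = (shift_op 0 ^^ s) (\<lambda>z. f_sst z * ?f z) \<mu> / (real n ^ s * f_sst \<mu>)"
    by (rule Suc)
  also have "(\<lambda>z. f_sst z * ?f z) = (\<lambda>z. (1 / real n) * shift_op 0 (\<lambda>\<rho>. f_sst \<rho> * f \<rho>) z)"
  proof
    fix z
    show "f_sst z * ?f z = (1 / real n) * shift_op 0 (\<lambda>\<rho>. f_sst \<rho> * f \<rho>) z"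
    proof (cases "strict z")
      case True
      then show ?thesis using num_sst_pos[of z] by (simp add: shift_op_def)
    next
      \<comment> \<open>The identity of functions must hold at every list; a list that is not strict
        covers nothing, so both sides are 0 there.\<close>
      case False
      then have "{\<tau>. \<tau> \<nearrow> z} = {}" using coversD by blast
      then show ?thesis by (simp add: shift_op_def down_op_def)
    qed
  qed
  finally show ?case
    unfolding shift_op_power_scale by (simp add: funpow_swap1 mult_ac)
qed

lemma shifted_plancherel_row:
  assumes "n \<ge> 1"
  shows "shifted_plancherel n [n] = 2 ^ n / (2 * fact n)"
proof -
  have "num_sst (row n) = 1" for n
  proof (induction n)
    case (Suc n)
    then show ?case
      using down_op_num_sst[OF strict_row, of "Suc n"] down_op_row[of f_sst n] by (simp add: row_def)
  qed (simp add: row_def num_sst_Nil)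
  from this[of n] show ?thesis
    using assms by (cases n) (simp_all add: row_def shifted_plancherel_def)
qed

lemma return_probability_row:
  assumes "n \<ge> 1"
  shows "chain_dist (DP n) (down_up n) [n] s [n] / shifted_plancherel n [n]
    = (\<Sum>k\<le>n. real (n choose k) * fact k * fps_nth odd_derangement_fps k * (real (n - k) / real n) ^ s)"
proof -
  have mem: "[n] \<in> DP n" using assms by (simp add: DP_def)
  then have pos: "0 < f_sst [n]" by (simp add: mem_DP_iff num_sst_pos)
  have row: "row n = [n]" using assms by (simp add: row_def)
  have "chain_dist (DP n) (down_up n) [n] s [n]
      = (\<Sum>\<rho>\<in>DP n. chain_dist (DP n) (down_up n) [n] s \<rho> * of_bool (\<rho> = [n]))"
    using mem finite_DP by (simp add: of_bool_def if_distrib cong: if_cong)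
  also have "\<dots> = (shift_op 0 ^^ s) (\<lambda>\<rho>. f_sst [n] * of_bool (\<rho> = [n])) [n] / (real n ^ s * f_sst [n])"
    unfolding sum_chain_dist_down_up[OF assms mem]
    by (intro arg_cong[of _ _ "\<lambda>f. (shift_op 0 ^^ s) f [n] / _"]) auto
  also have "\<dots> = (shift_op 0 ^^ s) (\<lambda>\<rho>. of_bool (\<rho> = [n])) [n] / real n ^ s"
    unfolding shift_op_power_scale using pos by simp
  finally have "chain_dist (DP n) (down_up n) [n] s [n] / shifted_plancherel n [n]
     = ((shift_op 0 ^^ s) (\<lambda>\<rho>. of_bool (\<rho> = row n)) (row n) * (if n = 0 then 1 else 2 * fact n / 2 ^ n)) / real n ^ s"
    using assms by (simp add: shifted_plancherel_row row)
  then show ?thesis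
    unfolding shift_op_power_row by (simp add: sum_divide_distrib power_divide)
qed

theorem theorem6p4:
  fixes n r :: nat and c :: real
  assumes "n \<ge> 1" and "c > 0"
    and "real r = 1 / 2 * real n * ln (real n) + c * real n"
  shows "tv_dist (DP n) (chain_dist (DP n) (down_up n) [n] r) (shifted_plancherel n)
           \<le> exp (- 3 * c) / 4"
proof -
  interpret reversible_chain "DP n" "down_up n" "shifted_plancherel n"
    by (rule reversible_chain_down_up) fact
  let ?E = "fps_nth odd_derangement_fps" and ?d = "tv_dist (DP n) (P [n] r) (shifted_plancherel n)"
  let ?a = "\<lambda>k. real (n choose k) * fact k * ?E k * (real (n - k) / real n) ^ (2 * r)"
  have mem: "[n] \<in> DP n" using assms by (simp add: DP_def)
  have decay: "(real (n - k) / real n) ^ (2 * r) \<le> exp (- 6 * c) / real n ^ k" if k: "3 \<le> k" "k \<le> n" for k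
  proof -
    have n: "0 < real n" using assms by simp
    have "real (n - k) / real n = 1 - real k / real n"
      using k n by (simp add: of_nat_diff diff_divide_distrib)
    also have "\<dots> \<le> exp (- (real k / real n))"
      using exp_ge_add_one_self[of "- (real k / real n)"] by simp
    finally have "(real (n - k) / real n) ^ (2 * r) \<le> exp (- (real k / real n)) ^ (2 * r)"
      by (intro power_mono) auto
    also have "\<dots> = exp (- (real k * (2 * real r / real n)))"
      by (simp add: exp_of_nat_mult[symmetric])
    \<comment> \<open>From 1 - x <= e^(-x) the k-th mode is at most e^(-2ck) / n^k, and
      \<open>k \<ge> 3\<close> turns the numerator into e^(-6c).\<close>
    also have "2 * real r / real n = ln (real n) + 2 * c"
      unfolding assms(3) using n by (simp add: field_simps)
    also have "exp (- (real k * (ln (real n) + 2 * c))) = exp (- (2 * c * real k)) / exp (real k * ln (real n))"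
      by (simp add: algebra_simps flip: exp_diff)
    also have "exp (real k * ln (real n)) = real n ^ k"
      using n by (simp add: exp_of_nat_mult)
    also have "exp (- (2 * c * real k)) / real n ^ k \<le> exp (- 6 * c) / real n ^ k"
      using k assms(2) by (intro divide_right_mono) auto
    finally show ?thesis .
  qed
  have summand_le: "?a k \<le> exp (- 6 * c) * (1/2) ^ k" if k: "3 \<le> k" "k \<le> n" for k
  proof -
    have "real (n choose k) * fact k = real ((n choose k) * fact k)" by simp
    \<comment> \<open>This growth is cancelled exactly by the n^k in the decay.\<close>
    also have "\<dots> \<le> real (n ^ k)"
      using binomial_fact_pow[of n k] by (simp only: of_nat_le_iff)
    finally have "?a k \<le> real n ^ k * (1/2) ^ k * (exp (- 6 * c) / real n ^ k)"
      using odd_derangement_fps_nth_bounds[of k] decay[OF k]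
      by (intro mult_mono) auto
    then show ?thesis using assms by (simp add: mult.commute)
  qed
  have geometric: "(\<Sum>k=3..n. (1/2) ^ k) \<le> (1/4 :: real)"
  proof -
    \<comment> \<open>The exact value of the sum, needed for the induction; for smaller
      \<open>n\<close> the sum is empty.\<close>
    have "(\<Sum>k=3..n. (1/2) ^ k) \<le> (1/4 - (1/2) ^ n :: real)" if "2 \<le> n"
      using that by (induction n rule: dec_induct) (auto simp: numeral_eq_Suc)
    moreover have "0 \<le> (1/2 :: real) ^ n" by simp
    ultimately show ?thesis by (cases "2 \<le> n") (linarith, simp)
  qed
  have "(2 * ?d)\<^sup>2 \<le> P [n] (2 * r) [n] / shifted_plancherel n [n] - 1"
    by (rule tv_dist_le[OF mem])
  \<comment> \<open>The term \<open>k = 0\<close> equals 1 and is the stationary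
    contribution.\<close>
  also have "\<dots> = sum ?a {..n} - ?a 0"
    using assms by (simp add: return_probability_row odd_derangement_fps_nth_0)
  also have "\<dots> = sum ?a ({..n} - {0})"
    by (subst sum_diff1) auto
  also have "\<dots> = sum ?a {3..n}"
  proof (rule sum.mono_neutral_right)
    show "\<forall>k\<in>{..n} - {0} - {3..n}. ?a k = 0"
    proof
      fix k assume "k \<in> {..n} - {0} - {3..n}"
      then have "k = Suc 0 \<or> k = Suc (Suc 0)" by auto
      then show "?a k = 0"
        using odd_derangement_fps_nth_1 odd_derangement_fps_nth_2 by auto
    qed
  qed auto
  also have "\<dots> \<le> (\<Sum>k=3..n. exp (- 6 * c) * (1/2) ^ k)"
    by (intro sum_mono summand_le) auto
  also have "\<dots> \<le> exp (- 6 * c) * (1/4)"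
    unfolding sum_distrib_left[symmetric] by (intro mult_left_mono geometric) auto
  also have "\<dots> = (exp (- 3 * c) / 2)\<^sup>2"
    by (simp add: power2_eq_square exp_add[symmetric])
  finally have "2 * ?d \<le> exp (- 3 * c) / 2"
    by (rule power2_le_imp_le) simp
  then show ?thesis by simp
qed

end
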